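(* Let $\mathcal{X}$ be a nearly unconditional basis of a Banach space $\mathbb{X}$. Suppose there are $0\le t<1/2$ and a constant $K$ such that the nearly truncation quasi-greedy function $\lambda$ of $\mathcal{X}$ satisfies $\lambda(a)\le K a^{-t}$ for all $0<a<1$. If $\mathbb{X}^*$ is a GT space, then $\mathcal{X}$ is equivalent to the unit vector basis of $c_0$.
   Context: $\mathbb{X}$ is an infinite-dimensional separable Banach space over the real or complex field $\mathbb{F}$. A basis of $\mathbb{X}$ is a norm-bounded sequence $\mathcal{X}=(x_n)_{n=1}^\infty$ with $\overline{\mathrm{span}}(x_n: n\in\mathbb{N})=\mathbb{X}$ for which there is a (unique) norm-bounded sequence $(x_n^* )_{n=1}^\infty$ in $\mathbb{X}^*$ such that $(x_n,x_n^* )_{n=1}^\infty$ is a biorthogonal system. For finite $A\subseteq\mathbb{N}$, $S_A(f)=\sum_{n\in A}x_n^*(f)\,x_n$. Put $\mathcal{Q}=\{f\in\mathbb{X}: \sup_n|x_n^*(f)|\le 1\}$ and, for $a>0$, $A(a,f)=\{n\in\mathbb{N}: |x_n^*(f)|\ge a\}$ (a finite set). The basis is nearly unconditional if for each $a\in(0,1)$ there is a constant $C$ such that $\|S_A(f)\|\le C\|f\|$ for all $f\in\mathcal{Q}$ and all $A\subseteq A(a,f)$. For $a\in(0,1)$ and $f\in\mathbb{X}$ put $$\mathcal{R}^{(a)}(f)=\min_{n\in A(a,f)}|x_n^*(f)|\sum_{n\in A(a,f)}\mathrm{sign}(x_n^*(f))\,x_n$$ (equal to $0$ if $A(a,f)=\emptyset$),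 where $\mathrm{sign}(z)=z/|z|$ for $z\ne0$. The nearly truncation quasi-greedy function $\lambda$ of $\mathcal{X}$ is defined by letting $\lambda(a)$, $0<a<1$, be the smallest constant $C$ such that $\|\mathcal{R}^{(a)}(f)\|\le C\|f\|$ for all $f\in\mathcal{Q}$. A Banach space $\mathbb{Y}$ is a GT space if every bounded linear operator $T\colon\mathbb{Y}\to\ell_2$ is absolutely summing, i.e., there is a constant $C$ such that for every finite family $(f_k)_{k\in B}$ in $\mathbb{Y}$, $$\sum_{k\in B}\|T(f_k)\|_2\le C\sup\left\{\left\|\sum_{k\in B}\varepsilon_kf_k\right\|: \varepsilon_k\in\mathbb{F},\ |\varepsilon_k|=1 \text{ for all } k\in B\right\}.$$ That $\mathcal{X}$ is equivalent to the unit vector basis $(e_n)_{n=1}^\infty$ of $c_0$ means that there is a linear isomorphism from $c_0$ onto $\mathbb{X}$ mapping $e_n$ to $x_n$ for every $n$. *)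

theory Defs
  imports "HOL-Analysis.Analysis"
begin

text \<open>
  The scalar field is real or complex. The embedding is an isometric field homomorphism over
  the reals, so the types of this class are exactly the copies of the two valued fields.
\<close>

class real_or_complex = real_normed_field +
  assumes real_or_complex:
    "\<exists>h :: 'a \<Rightarrow> complex.
       (\<forall>x y. h (x + y) = h x + h y) \<and> (\<forall>x y. h (x * y) = h x * h y) \<and>
       (\<forall>r x. h (r *\<^sub>R x) = r *\<^sub>R h x) \<and> (\<forall>x. cmod (h x) = norm x) \<and>
       (range h = \<real> \<or> range h = UNIV)"

instance real :: real_or_complex
proof
  show "\<exists>h :: real \<Rightarrow> complex.
       (\<forall>x y. h (x + y) = h x + h y) \<and> (\<forall>x y. h (x * y) = h x * h y) \<and>
       (\<forall>r x. h (r *\<^sub>R x) = r *\<^sub>R h x) \<and> (\<forall>x. cmod (h x) = norm x) \<and>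
       (range h = \<real> \<or> range h = UNIV)"
    by (rule exI[of _ complex_of_real]) (auto simp: Reals_def scaleR_conv_of_real)
qed

instance complex :: real_or_complex
proof
  show "\<exists>h :: complex \<Rightarrow> complex.
       (\<forall>x y. h (x + y) = h x + h y) \<and> (\<forall>x y. h (x * y) = h x * h y) \<and>
       (\<forall>r x. h (r *\<^sub>R x) = r *\<^sub>R h x) \<and> (\<forall>x. cmod (h x) = norm x) \<and>
       (range h = \<real> \<or> range h = UNIV)"
    by (rule exI[of _ "\<lambda>z. z"]) auto
qed

text \<open>
  A Banach space over \<open>'k\<close>: the type class \<open>banach\<close> provides the real Banach space, \<open>smul\<close> the
  multiplication by scalars of \<open>'k\<close>. For real scalars, \<open>smul\<close> is necessarily \<open>scaleR\<close>.
\<close>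

locale banach_over = vector_space smul
  for smul :: "'k::real_or_complex \<Rightarrow> 'a::banach \<Rightarrow> 'a" +
  assumes norm_smul: "norm (smul c v) = norm c * norm v"
    and smul_of_real: "smul (of_real r) v = r *\<^sub>R v"

lemma banach_over_scaleR: "banach_over (scaleR :: real \<Rightarrow> 'a::banach \<Rightarrow> 'a)"
  by standard (auto simp: algebra_simps)

definition infinite_dimensional :: "('k::field \<Rightarrow> 'a::ab_group_add \<Rightarrow> 'a) \<Rightarrow> bool" where
  "infinite_dimensional smul \<longleftrightarrow> \<not> (\<exists>B. finite B \<and> module.span smul B = UNIV)"

text \<open>
  The dual space, as a subspace of the bounded real-linear maps into the scalar field; the norm
  of \<open>'a \<Rightarrow>\<^sub>L 'k\<close> is the operator norm.
\<close>

definition dual_space ::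
    "('k::real_normed_field \<Rightarrow> 'a::real_normed_vector \<Rightarrow> 'a) \<Rightarrow> ('a \<Rightarrow>\<^sub>L 'k) set" where
  "dual_space smul =
     {\<phi>. \<forall>c v. blinfun_apply \<phi> (smul c v) = c * blinfun_apply \<phi> v}"

definition dual_scale ::
    "'k::real_normed_field \<Rightarrow> ('a::real_normed_vector \<Rightarrow>\<^sub>L 'k) \<Rightarrow> ('a \<Rightarrow>\<^sub>L 'k)" where
  "dual_scale c \<phi> = blinfun_mult_right c o\<^sub>L \<phi>"

lemma dual_scale_apply [simp]:
  "blinfun_apply (dual_scale c \<phi>) v = c * blinfun_apply \<phi> v"
  by (simp add: dual_scale_def)

text \<open>
  The coordinate functionals \<open>xs\<close> are carried as a parameter next to the basis \<open>x\<close>; they are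
  unique by \<open>coordinate_functionals_unique\<close> below.
\<close>

definition basis ::
    "('k::real_or_complex \<Rightarrow> 'a::banach \<Rightarrow> 'a) \<Rightarrow> (nat \<Rightarrow> 'a) \<Rightarrow> (nat \<Rightarrow> 'a \<Rightarrow>\<^sub>L 'k) \<Rightarrow> bool" where
  "basis smul x xs \<longleftrightarrow>
     bounded (range x) \<and> closure (module.span smul (range x)) = UNIV \<and>
     (\<forall>n. xs n \<in> dual_space smul) \<and> bounded (range xs) \<and>
     (\<forall>m n. blinfun_apply (xs m) (x n) = (if m = n then 1 else 0))"

lemma coordinate_functionals_unique:
  assumes "banach_over smul" "basis smul x xs" "basis smul x ys"
  shows "xs = ys"
proof (rule ext, rule blinfun_eqI)
  fix n v
  interpret banach_over smul by fact
  let ?S = "{u. blinfun_apply (xs n) u = blinfun_apply (ys n) u}"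
  have "subspace ?S"
    using assms(2,3)
    by (auto simp: subspace_def basis_def dual_space_def blinfun.add_right)
  moreover have "range x \<subseteq> ?S"
    using assms(2,3) by (auto simp: basis_def)
  ultimately have "span (range x) \<subseteq> ?S"
    by (rule span_minimal[rotated])
  moreover have "closed ?S"
    by (intro closed_Collect_eq continuous_intros)
  ultimately have "closure (span (range x)) \<subseteq> ?S"
    by (rule closure_minimal)
  then show "blinfun_apply (xs n) v = blinfun_apply (ys n) v"
    using assms(2) by (auto simp: basis_def)
qed

definition coordinate_projection ::
    "('k::real_normed_field \<Rightarrow> 'a::real_normed_vector \<Rightarrow> 'a) \<Rightarrow> (nat \<Rightarrow> 'a) \<Rightarrow> (nat \<Rightarrow> 'a \<Rightarrow>\<^sub>L 'k)
      \<Rightarrow> nat set \<Rightarrow> 'a \<Rightarrow> 'a" where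
  "coordinate_projection smul x xs A f = (\<Sum>n\<in>A. smul (blinfun_apply (xs n) f) (x n))"

definition unit_coordinates ::
    "(nat \<Rightarrow> 'a::real_normed_vector \<Rightarrow>\<^sub>L 'k::real_normed_field) \<Rightarrow> 'a set" where
  "unit_coordinates xs = {f. \<forall>n. norm (blinfun_apply (xs n) f) \<le> 1}"

definition large_coordinates ::
    "(nat \<Rightarrow> 'a::real_normed_vector \<Rightarrow>\<^sub>L 'k::real_normed_field) \<Rightarrow> real \<Rightarrow> 'a \<Rightarrow> nat set" where
  "large_coordinates xs a f = {n. a \<le> norm (blinfun_apply (xs n) f)}"

definition nearly_unconditional ::
    "('k::real_normed_field \<Rightarrow> 'a::real_normed_vector \<Rightarrow> 'a) \<Rightarrow> (nat \<Rightarrow> 'a) \<Rightarrow> (nat \<Rightarrow> 'a \<Rightarrow>\<^sub>L 'k)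
      \<Rightarrow> bool" where
  "nearly_unconditional smul x xs \<longleftrightarrow>
     (\<forall>a\<in>{0<..<1}. \<exists>C. \<forall>f\<in>unit_coordinates xs. \<forall>A \<subseteq> large_coordinates xs a f.
        norm (coordinate_projection smul x xs A f) \<le> C * norm f)"

definition restricted_truncation ::
    "('k::real_normed_field \<Rightarrow> 'a::real_normed_vector \<Rightarrow> 'a) \<Rightarrow> (nat \<Rightarrow> 'a) \<Rightarrow> (nat \<Rightarrow> 'a \<Rightarrow>\<^sub>L 'k)
      \<Rightarrow> real \<Rightarrow> 'a \<Rightarrow> 'a" where
  "restricted_truncation smul x xs a f =
     (let A = large_coordinates xs a f in
      if A = {} then 0
      else Min ((\<lambda>n. norm (blinfun_apply (xs n) f)) ` A) *\<^sub>R
             (\<Sum>n\<in>A. smul (sgn (blinfun_apply (xs n) f)) (x n)))"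

text \<open>Extended-real valued: \<open>\<infinity>\<close> if there is no admissible constant.\<close>

definition nearly_tqg_function ::
    "('k::real_normed_field \<Rightarrow> 'a::real_normed_vector \<Rightarrow> 'a) \<Rightarrow> (nat \<Rightarrow> 'a) \<Rightarrow> (nat \<Rightarrow> 'a \<Rightarrow>\<^sub>L 'k)
      \<Rightarrow> real \<Rightarrow> ereal" where
  "nearly_tqg_function smul x xs a =
     Inf (ereal ` {C. \<forall>f\<in>unit_coordinates xs.
            norm (restricted_truncation smul x xs a f) \<le> C * norm f})"

definition ell2 :: "(nat \<Rightarrow> 'k::real_normed_field) set" where
  "ell2 = {a. summable (\<lambda>n. (norm (a n))\<^sup>2)}"

definition ell2_norm :: "(nat \<Rightarrow> 'k::real_normed_field) \<Rightarrow> real" where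
  "ell2_norm a = sqrt (\<Sum>n. (norm (a n))\<^sup>2)"

text \<open>
  In the following three definitions, the Banach space \<open>\<bbbY>\<close> is the set \<open>Y\<close> with scalar
  multiplication \<open>smul\<close> and the norm of the surrounding type.
\<close>

definition bounded_operator_ell2 ::
    "('k::real_normed_field \<Rightarrow> 'b::real_normed_vector \<Rightarrow> 'b) \<Rightarrow> 'b set \<Rightarrow> ('b \<Rightarrow> nat \<Rightarrow> 'k) \<Rightarrow> bool"
  where
  "bounded_operator_ell2 smul Y T \<longleftrightarrow>
     (\<forall>u\<in>Y. T u \<in> ell2) \<and>
     (\<forall>u\<in>Y. \<forall>v\<in>Y. \<forall>n. T (u + v) n = T u n + T v n) \<and>
     (\<forall>c. \<forall>u\<in>Y. \<forall>n. T (smul c u) n = c * T u n) \<and>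
     (\<exists>M. \<forall>u\<in>Y. ell2_norm (T u) \<le> M * norm u)"

definition absolutely_summing_ell2 ::
    "('k::real_normed_field \<Rightarrow> 'b::real_normed_vector \<Rightarrow> 'b) \<Rightarrow> 'b set \<Rightarrow> ('b \<Rightarrow> nat \<Rightarrow> 'k) \<Rightarrow> bool"
  where
  "absolutely_summing_ell2 smul Y T \<longleftrightarrow>
     (\<exists>C. \<forall>B :: nat set. \<forall>f. finite B \<longrightarrow> (\<forall>k\<in>B. f k \<in> Y) \<longrightarrow>
        (\<Sum>k\<in>B. ell2_norm (T (f k)))
          \<le> C * (SUP \<epsilon>\<in>{\<epsilon>. \<forall>k\<in>B. norm (\<epsilon> k) = 1}. norm (\<Sum>k\<in>B. smul (\<epsilon> k) (f k))))"

definition GT_space ::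
    "('k::real_normed_field \<Rightarrow> 'b::real_normed_vector \<Rightarrow> 'b) \<Rightarrow> 'b set \<Rightarrow> bool" where
  "GT_space smul Y \<longleftrightarrow>
     (\<forall>T. bounded_operator_ell2 smul Y T \<longrightarrow> absolutely_summing_ell2 smul Y T)"

definition c0 :: "(nat \<Rightarrow> 'k::real_normed_field) set" where
  "c0 = {a. a \<longlonglongrightarrow> 0}"

definition c0_norm :: "(nat \<Rightarrow> 'k::real_normed_field) \<Rightarrow> real" where
  "c0_norm a = (SUP n. norm (a n))"

definition c0_isomorphism ::
    "('k::real_normed_field \<Rightarrow> 'a::real_normed_vector \<Rightarrow> 'a) \<Rightarrow> ((nat \<Rightarrow> 'k) \<Rightarrow> 'a) \<Rightarrow> bool" where
  "c0_isomorphism smul \<Phi> \<longleftrightarrow>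
     (\<forall>a\<in>c0. \<forall>b\<in>c0. \<Phi> (\<lambda>n. a n + b n) = \<Phi> a + \<Phi> b) \<and>
     (\<forall>c. \<forall>a\<in>c0. \<Phi> (\<lambda>n. c * a n) = smul c (\<Phi> a)) \<and>
     bij_betw \<Phi> c0 UNIV \<and>
     (\<exists>M. \<forall>a\<in>c0. norm (\<Phi> a) \<le> M * c0_norm a) \<and>
     (\<exists>M. \<forall>a\<in>c0. c0_norm a \<le> M * norm (\<Phi> a))"

definition equivalent_to_c0_basis ::
    "('k::real_normed_field \<Rightarrow> 'a::real_normed_vector \<Rightarrow> 'a) \<Rightarrow> (nat \<Rightarrow> 'a) \<Rightarrow> bool" where
  "equivalent_to_c0_basis smul x \<longleftrightarrow>
     (\<exists>\<Phi>. c0_isomorphism smul \<Phi> \<and> (\<forall>n. \<Phi> (\<lambda>m. if m = n then 1 else 0) = x n))"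

end

(*
  Let Phi be the supremum of the norms of sums of c_n x_n over a finite set A of indices, with
  |c_n| <= 1. Since the x_n are bounded, T u = (u(x_n)) for n in A maps the dual into l_2 with
  norm at most a constant times Phi^(1/2). Applied to the functionals w_n xs_n, the GT property
  bounds P = sum of w_n by a constant times Phi^(1/2) times the supremum over the unit ball of
  the sums of w_n |xs_n(f)|. Take w_n = |u(x_n)| for a functional u of norm one, so that P can be
  made equal to any of the norms in the definition of Phi. The part of w carried by the indices
  with |xs_n(f)| >= a is then at most a constant times a^(-1-t), by truncation followed by near
  unconditionality, and t may be increased to 1/2. Summing over a = 4^(-j), j <= J, yields
  P <= const Phi^(1/2) (2^J + 4^(-J) P). The choice 4^J ~ Phi^(1/2) gives
  Phi <= const Phi^(3/4), hence a bound for Phi that does not depend on A.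
*)
theory Submission
  imports Defs
begin

section \<open>Norming functionals\<close>

definition sublinear :: "('a::real_vector \<Rightarrow> real) \<Rightarrow> bool" where
  "sublinear q \<longleftrightarrow> (\<forall>u v. q (u + v) \<le> q u + q v) \<and> (\<forall>r u. 0 \<le> r \<longrightarrow> q (r *\<^sub>R u) = r * q u)"

lemma sublinear_add: "sublinear q \<Longrightarrow> q (u + v) \<le> q u + q v"
  by (simp add: sublinear_def)

lemma sublinear_scaleR: "sublinear q \<Longrightarrow> 0 \<le> r \<Longrightarrow> q (r *\<^sub>R u) = r * q u"
  by (simp add: sublinear_def)

lemma sublinear_zero: "sublinear q \<Longrightarrow> q 0 = 0"
  using sublinear_scaleR[of q 0 0] by simp

lemma sublinear_minus: "sublinear q \<Longrightarrow> - q (- u) \<le> q u"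
  using sublinear_add[of q u "- u"] sublinear_zero[of q] by simp

text \<open>Both infima of the Hahn-Banach argument, over a chain and over shifts, have this shape:
  \<open>directed\<close> replaces two competing members by one that handles the sum, and
  \<open>bdd\<close> keeps the real infimum meaningful. Scaling is assumed as an inequality only;
  the reverse follows by applying it to the inverse factor.\<close>

lemma sublinear_INF:
  assumes C: "C \<noteq> {}" "\<And>c u r. c \<in> C \<Longrightarrow> 0 \<le> r \<Longrightarrow> \<exists>d\<in>C. d (r *\<^sub>R u) \<le> r * c u"
    and directed: "\<And>c d u v. c \<in> C \<Longrightarrow> d \<in> C \<Longrightarrow> \<exists>e\<in>C. e (u + v) \<le> c u + d v"
    and bdd: "\<And>u. bdd_below ((\<lambda>c. c u) ` C)"
    and zero: "\<And>c. c \<in> C \<Longrightarrow> 0 \<le> c (0::'a::real_vector)"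
  shows "sublinear (\<lambda>u. INF c\<in>C. c u :: real)"
  unfolding sublinear_def
proof (intro conjI allI impI)
  let ?q = "\<lambda>u. INF c\<in>C. c u"
  have low: "?q u \<le> c u" if "c \<in> C" for c u
    using bdd that by (rule cINF_lower)
  show "?q (u + v) \<le> ?q u + ?q v" for u v
  proof -
    have "?q (u + v) - d v \<le> ?q u" if d: "d \<in> C" for d
    proof (rule cINF_greatest)
      show "?q (u + v) - d v \<le> c u" if c: "c \<in> C" for c
        using directed[OF c d, of u v] low[of _ "u + v"] by fastforce
    qed (rule C)
    then have "?q (u + v) - ?q u \<le> ?q v"
      by (intro cINF_greatest C) (simp add: algebra_simps)
    then show ?thesis by simp
  qed
  have scale: "?q (r *\<^sub>R u) \<le> r * ?q u" if r: "0 < r" for r u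
  proof -
    have "?q (r *\<^sub>R u) / r \<le> ?q u"
    proof (rule cINF_greatest)
      show "?q (r *\<^sub>R u) / r \<le> c u" if c: "c \<in> C" for c
        using C(2)[OF c, of r u] low[of _ "r *\<^sub>R u"] r by (fastforce simp: field_simps)
    qed (rule C)
    then show ?thesis using r by (simp add: field_simps)
  qed
  show "?q (r *\<^sub>R u) = r * ?q u" if r: "0 \<le> r" for r u
  proof (cases "r = 0")
    case True
    obtain c where c: "c \<in> C" using C(1) by blast
    obtain d where "d \<in> C" "d (0 *\<^sub>R 0) \<le> 0 * c 0" using C(2)[OF c, of 0 0] by auto
    then have "?q 0 \<le> 0" using low[of d 0] by simp
    moreover have "0 \<le> ?q 0" by (intro cINF_greatest C zero)
    ultimately show ?thesis using True by simp
  next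
    case False
    then have "0 < r" using r by simp
    moreover have "r * ?q u = r * ?q (inverse r *\<^sub>R (r *\<^sub>R u))" using False by simp
    moreover have "\<dots> \<le> r * (inverse r * ?q (r *\<^sub>R u))"
      using \<open>0 < r\<close> by (intro mult_left_mono scale) auto
    ultimately show ?thesis using scale[of r u] False by (simp add: field_simps)
  qed
qed

text \<open>\<open>p\<close> is the infimum of \<open>q (u + t *\<^sub>R v) - t * q v\<close> over t
  \<ge> 0: t = 0 gives \<open>p \<le> q\<close>, t = 1 the last bound, and subadditivity bounds the
  family below by \<open>- q (- u)\<close>. For a minimal \<open>q\<close> this forces
  superadditivity; for the norm it singles out the direction \<open>v\<close>.\<close>

lemma sublinear_shift:
  assumes q: "sublinear q"
  obtains p where "sublinear p" "p \<le> q" "\<And>u. p u \<le> q (u + v) - q v"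
proof -
  define C where "C = (\<lambda>t u. q (u + t *\<^sub>R v) - t * q v) ` {0..}"
  have mem: "(\<lambda>u. q (u + t *\<^sub>R v) - t * q v) \<in> C" if "0 \<le> t" for t
    using that by (auto simp: C_def)
  have lb: "- q (- u) \<le> q (u + t *\<^sub>R v) - t * q v" if "0 \<le> t" for t u
    using sublinear_add[OF q, of "u + t *\<^sub>R v" "- u"] sublinear_scaleR[OF q that, of v] by simp
  have bdd: "bdd_below ((\<lambda>c. c u) ` C)" for u
    by (rule bdd_belowI[of _ "- q (- u)"]) (auto simp: C_def lb)
  have "sublinear (\<lambda>u. INF c\<in>C. c u)"
  proof (rule sublinear_INF)
    show "C \<noteq> {}" by (auto simp: C_def)
    show "bdd_below ((\<lambda>c. c u) ` C)" for u by (rule bdd)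
    show "0 \<le> c 0" if "c \<in> C" for c
      using that sublinear_scaleR[OF q, of _ v] by (auto simp: C_def)
    show "\<exists>d\<in>C. d (r *\<^sub>R u) \<le> r * c u" if c: "c \<in> C" and r: "0 \<le> r" for c u r
    proof -
      obtain t where t: "0 \<le> t" "c = (\<lambda>u. q (u + t *\<^sub>R v) - t * q v)"
        using c by (auto simp: C_def)
      have "q (r *\<^sub>R u + (r * t) *\<^sub>R v) = r * q (u + t *\<^sub>R v)"
        using sublinear_scaleR[OF q r, of "u + t *\<^sub>R v"] by (simp add: scaleR_add_right)
      then show ?thesis using t r
        by (intro bexI[OF _ mem[of "r * t"]]) (auto simp: algebra_simps)
    qed
    show "\<exists>e\<in>C. e (u + w) \<le> c u + d w" if cd: "c \<in> C" "d \<in> C" for c d u w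
    proof -
      obtain t s where t: "0 \<le> t" "c = (\<lambda>u. q (u + t *\<^sub>R v) - t * q v)"
        and s: "0 \<le> s" "d = (\<lambda>u. q (u + s *\<^sub>R v) - s * q v)"
        using cd by (auto simp: C_def)
      have "q (u + w + (t + s) *\<^sub>R v) \<le> q (u + t *\<^sub>R v) + q (w + s *\<^sub>R v)"
        using sublinear_add[OF q, of "u + t *\<^sub>R v" "w + s *\<^sub>R v"] by (simp add: algebra_simps)
      then show ?thesis using t s
        by (intro bexI[OF _ mem[of "t + s"]]) (auto simp: algebra_simps)
    qed
  qed
  moreover have le: "(INF c\<in>C. c u) \<le> q (u + t *\<^sub>R v) - t * q v" if "0 \<le> t" for t u
    using cINF_lower[OF bdd, of "\<lambda>u. q (u + t *\<^sub>R v) - t * q v" u] that by (auto simp: C_def)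
  ultimately show ?thesis
    using le[of 0] le[of 1] by (intro that) (auto simp: le_fun_def)
qed

text \<open>Zorn yields a pointwise minimal sublinear functional below \<open>p\<close>. No shift
  can lower it, so it is superadditive and hence linear.\<close>

lemma linear_below_sublinear:
  assumes p: "sublinear p"
  obtains g :: "'a::real_vector \<Rightarrow> real" where "linear g" "g \<le> p"
proof -
  define S where "S = {q. sublinear q \<and> q \<le> p}"
  have "\<exists>m\<in>S. \<forall>a\<in>S. a \<le> m \<longrightarrow> a = m"
  proof (rule predicate_Zorn)
    \<comment> \<open>The order is reversed: upper bounds of chains are pointwise infima, and a
      maximal element is a minimal functional.\<close>
    show "partial_order_on S (relation_of (\<lambda>a b. b \<le> a) S)"
      by (rule partial_order_on_relation_ofI) auto
    show "\<exists>u\<in>S. \<forall>a\<in>C. u \<le> a" if "C \<in> Chains (relation_of (\<lambda>a b. b \<le> a) S)" for C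
    proof (cases "C = {}")
      case True
      then show ?thesis using p by (auto simp: S_def)
    next
      case False
      have chain: "c \<le> d \<or> d \<le> c" if "c \<in> C" "d \<in> C" for c d
        using \<open>C \<in> _\<close> that by (auto simp: Chains_def relation_of_def)
      have CS: "C \<subseteq> S"
        using \<open>C \<in> _\<close> by (auto simp: Chains_def relation_of_def)
      \<comment> \<open>Every member satisfies \<open>c u \<ge> - c (- u) \<ge> - p (- u)\<close>,
        one bound for the whole chain.\<close>
      have bdd: "bdd_below ((\<lambda>c. c u) ` C)" for u
      proof (rule bdd_belowI[of _ "- p (- u)"])
        fix y assume "y \<in> (\<lambda>c. c u) ` C"
        then obtain c where c: "c \<in> C" "y = c u" by auto
        then have "sublinear c" "c (- u) \<le> p (- u)" using CS by (auto simp: S_def le_fun_def)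
        then show "- p (- u) \<le> y" using sublinear_minus[of c u] c by simp
      qed
      have "sublinear (\<lambda>u. INF c\<in>C. c u)"
      proof (rule sublinear_INF[OF False _ _ bdd])
        show "0 \<le> c 0" if "c \<in> C" for c
          using that CS sublinear_zero[of c] by (auto simp: S_def)
        show "\<exists>d\<in>C. d (r *\<^sub>R u) \<le> r * c u" if "c \<in> C" "0 \<le> r" for c u r
          using that CS sublinear_scaleR[of c r u] by (auto simp: S_def intro!: bexI[of _ c])
        show "\<exists>e\<in>C. e (u + v) \<le> c u + d v" if cd: "c \<in> C" "d \<in> C" for c d u v
        proof -
          obtain e where e: "e \<in> C" "e \<le> c" "e \<le> d" using chain[OF cd] cd by auto
          then have "sublinear e" using CS by (auto simp: S_def)
          then have "e (u + v) \<le> c u + d v"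
            using sublinear_add[of e u v] e by (fastforce simp: le_fun_def intro: order_trans add_mono)
          then show ?thesis using e by blast
        qed
      qed
      moreover have le: "(\<lambda>u. INF c\<in>C. c u) \<le> c" if "c \<in> C" for c
        using cINF_lower[OF bdd that] by (auto simp: le_fun_def)
      moreover obtain c where "c \<in> C" "c \<le> p" using False CS by (auto simp: S_def)
      ultimately have "(\<lambda>u. INF c\<in>C. c u) \<in> S" by (auto simp: S_def intro: order_trans)
      then show ?thesis using le by blast
    qed
  qed
  then obtain m where m: "m \<in> S" and min: "\<And>a. a \<in> S \<Longrightarrow> a \<le> m \<Longrightarrow> a = m" by blast
  have sub: "sublinear m" using m by (simp add: S_def)
  \<comment> \<open>Minimality identifies \<open>m\<close> with its shift by
    \<open>v\<close>.\<close>
  have super: "m u + m v \<le> m (u + v)" for u v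
  proof -
    obtain q where q: "sublinear q" "q \<le> m" "\<And>u. q u \<le> m (u + v) - m v"
      using sublinear_shift[OF sub] by metis
    then have "q = m" using m by (intro min) (auto simp: S_def)
    then show ?thesis using q(3)[of u] by simp
  qed
  then have add: "m (u + v) = m u + m v" for u v
    using sublinear_add[OF sub, of u v] by (simp add: order_antisym)
  then have neg: "m (- u) = - m u" for u
    using add[of u "- u"] sublinear_zero[OF sub] by simp
  have "m (r *\<^sub>R u) = r * m u" for r u
    using sublinear_scaleR[OF sub, of r u] sublinear_scaleR[OF sub, of "- r" u] neg[of "r *\<^sub>R u"]
    by (cases "0 \<le> r") auto
  then have "linear m" by (intro linearI add) auto
  then show ?thesis using m that by (auto simp: S_def)
qed

text \<open>The functional is taken below the shift of the norm by \<open>v\<close> rather than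
  below the norm itself: at \<open>- v\<close> that shift is at most \<open>- norm v\<close>, which
  forces equality at \<open>v\<close>. It is only real-linear.\<close>

lemma norming_functional:
  fixes v :: "'a::real_normed_vector"
  obtains g :: "'a \<Rightarrow> real" where "linear g" "\<And>u. \<bar>g u\<bar> \<le> norm u" "g v = norm v"
proof -
  have "sublinear (norm :: 'a \<Rightarrow> real)"
    by (simp add: sublinear_def norm_triangle_ineq)
  then obtain p where p: "sublinear p" "p \<le> norm" "\<And>u. p u \<le> norm (u + v) - norm v"
    using sublinear_shift by metis
  obtain g where g: "linear g" "g \<le> p" using linear_below_sublinear[OF p(1)] by metis
  have le: "g u \<le> norm u" for u using g(2) p(2) by (meson le_funD order_trans)
  have bound: "\<bar>g u\<bar> \<le> norm u" for u
    using le[of u] le[of "- u"] linear_neg[OF g(1), of u] by simp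
  have "g (- v) \<le> - norm v" using g(2) p(3)[of "- v"] by (simp add: le_fun_def) (metis order_trans)
  then have "g v = norm v" using linear_neg[OF g(1), of v] le[of v] by simp
  then show ?thesis using that g(1) bound by blast
qed

text \<open>\<open>J\<close> is the imaginary unit, or 0 for real scalars, so that a real-linear
  functional can be compared with scalar multiplication in both cases at once.\<close>

lemma real_or_complex_coordinates:
  obtains J :: "'k::real_or_complex" where "norm J \<le> 1"
    "\<And>z. \<exists>\<alpha> \<beta>. z = of_real \<alpha> + of_real \<beta> * J \<and> \<bar>\<alpha>\<bar> \<le> norm z \<and> \<bar>\<beta>\<bar> \<le> norm z"
proof -
  obtain h :: "'k \<Rightarrow> complex" where h: "\<And>x y. h (x + y) = h x + h y"
    "\<And>x y. h (x * y) = h x * h y" "\<And>r x. h (r *\<^sub>R x) = r *\<^sub>R h x"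
    "\<And>x. cmod (h x) = norm x" "range h = \<real> \<or> range h = UNIV"
    using real_or_complex by metis
  have "linear h" using h by (intro linearI) auto
  have inj: "x = y" if "h x = h y" for x y
    using that linear_diff[OF \<open>linear h\<close>, of x y] h(4)[of "x - y"] by simp
  \<comment> \<open>A nonzero idempotent of a field is 1.\<close>
  have "h 1 * h 1 = h 1" "h 1 \<noteq> 0" using h(2)[of 1 1] h(4)[of 1] by auto
  then have "h 1 = 1" by simp
  then have of_real: "h (of_real r) = of_real r" for r
    using h(3)[of r 1] by (simp add: of_real_def)
  from h(5) show ?thesis
  proof
    assume R: "range h = \<real>"
    show ?thesis
    proof (rule that[of 0])
      fix z
      have "h z \<in> \<real>" using R by auto
      then obtain r where "h z = of_real r" by (auto simp: Reals_def)
      then have "z = of_real r" by (intro inj) (simp add: of_real)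
      then show "\<exists>\<alpha> \<beta>. z = of_real \<alpha> + of_real \<beta> * 0 \<and> \<bar>\<alpha>\<bar> \<le> norm z \<and> \<bar>\<beta>\<bar> \<le> norm z"
        by (intro exI[of _ r] exI[of _ 0]) simp
    qed simp
  next
    assume "range h = UNIV"
    then obtain J where J: "h J = \<i>" by (metis surjE)
    show ?thesis
    proof (rule that[of J])
      show "norm J \<le> 1" using h(4)[of J] J by simp
      fix z
      have "z = of_real (Re (h z)) + of_real (Im (h z)) * J"
        by (rule inj) (simp add: h(1,2) of_real J complex_eq_iff)
      then show "\<exists>\<alpha> \<beta>. z = of_real \<alpha> + of_real \<beta> * J \<and> \<bar>\<alpha>\<bar> \<le> norm z \<and> \<bar>\<beta>\<bar> \<le> norm z"
        using abs_Re_le_cmod[of "h z"] abs_Im_le_cmod[of "h z"] h(4)[of z] by auto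
    qed
  qed
qed

section \<open>Operators into the sequence space l2 on GT spaces\<close>

text \<open>Later estimates supply an upper bound \<open>b\<close> instead of the supremum. The
  bound makes the real SUP meaningful, and the constant is made nonnegative so that \<open>b\<close>
  may replace the SUP.\<close>

lemma absolutely_summing_ell2_bound:
  assumes "absolutely_summing_ell2 smul Y T"
  obtains C where "0 \<le> C"
    "\<And>B f b. finite B \<Longrightarrow> (\<And>k. k \<in> B \<Longrightarrow> f k \<in> Y) \<Longrightarrow>
       (\<And>\<epsilon>. (\<forall>k\<in>B. norm (\<epsilon> k) = 1) \<Longrightarrow> norm (\<Sum>k\<in>B. smul (\<epsilon> k) (f k)) \<le> b) \<Longrightarrow>
       (\<Sum>k\<in>(B :: nat set). ell2_norm (T (f k))) \<le> C * b"
proof -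
  obtain C where C: "\<And>(B :: nat set) f. finite B \<Longrightarrow> (\<forall>k\<in>B. f k \<in> Y) \<Longrightarrow>
        (\<Sum>k\<in>B. ell2_norm (T (f k)))
          \<le> C * (SUP \<epsilon>\<in>{\<epsilon>. \<forall>k\<in>B. norm (\<epsilon> k) = 1}. norm (\<Sum>k\<in>B. smul (\<epsilon> k) (f k)))"
    using assms unfolding absolutely_summing_ell2_def by blast
  show ?thesis
  proof (rule that[of "max C 0"])
    fix B :: "nat set" and f b
    assume fin: "finite B" and f: "\<And>k. k \<in> B \<Longrightarrow> f k \<in> Y"
      and b: "\<And>\<epsilon>. (\<forall>k\<in>B. norm (\<epsilon> k) = 1) \<Longrightarrow> norm (\<Sum>k\<in>B. smul (\<epsilon> k) (f k)) \<le> b"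
    let ?E = "{\<epsilon> :: nat \<Rightarrow> 'a. \<forall>k\<in>B. norm (\<epsilon> k) = 1}"
    let ?n = "\<lambda>\<epsilon>. norm (\<Sum>k\<in>B. smul (\<epsilon> k) (f k))"
    have ne: "?E \<noteq> {}" by (auto intro: exI[of _ "\<lambda>_. 1"])
    have bdd: "bdd_above (?n ` ?E)" by (rule bdd_aboveI[of _ b]) (auto intro: b)
    have "0 \<le> ?n (\<lambda>_. 1)" by simp
    also have "\<dots> \<le> (SUP \<epsilon>\<in>?E. ?n \<epsilon>)" by (rule cSUP_upper[OF _ bdd]) simp
    finally have nonneg: "0 \<le> (SUP \<epsilon>\<in>?E. ?n \<epsilon>)" .
    have "(\<Sum>k\<in>B. ell2_norm (T (f k))) \<le> C * (SUP \<epsilon>\<in>?E. ?n \<epsilon>)"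
      by (intro C fin ballI f)
    also have "\<dots> \<le> max C 0 * (SUP \<epsilon>\<in>?E. ?n \<epsilon>)"
      by (intro mult_right_mono nonneg) simp
    also have "\<dots> \<le> max C 0 * b"
      by (intro mult_left_mono cSUP_least ne) (simp_all add: b)
    finally show "(\<Sum>k\<in>B. ell2_norm (T (f k))) \<le> max C 0 * b" .
  qed simp
qed

text \<open>The rows \<open>v j\<close>, damped by 2^-j, are laid out along the pairing of the
  naturals. Their squares carry the weights 4^-j, whose sum is below 4; reading off one row undoes
  the damping at the cost \<open>2 ^ j\<close>.\<close>

lemma
  fixes v :: "nat \<Rightarrow> nat \<Rightarrow> 'k::real_normed_field"
  assumes v: "\<And>j. v j \<in> ell2" "\<And>j. ell2_norm (v j) \<le> N"
  defines "c \<equiv> \<lambda>i. case prod_decode i of (j, n) \<Rightarrow> of_real ((1/2) ^ j) * v j n"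
  shows ell2_concat: "c \<in> ell2"
    and ell2_norm_concat_le: "ell2_norm c \<le> 2 * N"
    and ell2_norm_le_concat: "ell2_norm (v j) \<le> 2 ^ j * ell2_norm c"
proof -
  let ?a = "\<lambda>(j, n). ((norm (of_real ((1/2) ^ j) * v j n))\<^sup>2 :: real)"
  have cn: "(norm (c i))\<^sup>2 = ?a (prod_decode i)" for i
    by (simp add: c_def split: prod.splits)
  have a: "(norm (of_real ((1/2) ^ j) * v j n))\<^sup>2 = (1/4) ^ j * (norm (v j n))\<^sup>2" for j n
  proof -
    have "norm (of_real ((1/2) ^ j) * v j n) = (1/2) ^ j * norm (v j n)"
      by (simp only: norm_mult norm_of_real) simp
    moreover have "((1/2 :: real) ^ j)\<^sup>2 = (1/4) ^ j"
      using power_mult_distrib[of "1/2 :: real" "1/2" j] by (simp add: power2_eq_square)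
    ultimately show ?thesis by (simp only: power_mult_distrib)
  qed
  have "0 \<le> ell2_norm (v 0)"
    using v(1)[of 0] by (auto simp: ell2_norm_def ell2_def intro!: suminf_nonneg)
  then have N: "0 \<le> N" using v(2)[of 0] by simp
  have sq: "(\<Sum>n. (norm (v j n))\<^sup>2) \<le> N\<^sup>2" for j
    using v(2)[of j] by (simp add: ell2_norm_def sqrt_le_D)
  have partial: "(\<Sum>i<m. (norm (c i))\<^sup>2) \<le> (2 * N)\<^sup>2" for m
  proof -
    have "(\<Sum>i<m. (norm (c i))\<^sup>2) = sum ?a (prod_decode ` {..<m})"
      by (simp add: sum.reindex[OF inj_prod_decode] cn)
    \<comment> \<open>A pairing code dominates both of its entries, so the codes below
      \<open>m\<close> lie in a square.\<close>
    also have "\<dots> \<le> sum ?a ({..<m} \<times> {..<m})"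
    proof (rule sum_mono2)
      show "prod_decode ` {..<m} \<subseteq> {..<m} \<times> {..<m}"
      proof
        fix p assume "p \<in> prod_decode ` {..<m}"
        then have "prod_encode p < m" by auto
        then show "p \<in> {..<m} \<times> {..<m}"
          using le_prod_encode_1[of "fst p" "snd p"] le_prod_encode_2[of "snd p" "fst p"]
          by (cases p) auto
      qed
    qed auto
    also have "\<dots> = (\<Sum>j<m. (1/4) ^ j * (\<Sum>n<m. (norm (v j n))\<^sup>2))"
      by (simp add: sum.cartesian_product[symmetric] a sum_distrib_left del: of_real_power of_real_divide)
    also have "\<dots> \<le> (\<Sum>j<m. (1/4) ^ j * N\<^sup>2)"
    proof (intro sum_mono mult_left_mono)
      fix j
      have "(\<Sum>n<m. (norm (v j n))\<^sup>2) \<le> (\<Sum>n. (norm (v j n))\<^sup>2)"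
        using v(1)[of j] by (intro sum_le_suminf) (auto simp: ell2_def)
      then show "(\<Sum>n<m. (norm (v j n))\<^sup>2) \<le> N\<^sup>2" using sq[of j] by simp
    qed auto
    also have "\<dots> = (\<Sum>j<m. (1/4) ^ j) * N\<^sup>2" by (simp add: sum_distrib_right)
    also have "(\<Sum>j<m. (1/4::real) ^ j) = (1 - (1/4) ^ m) * (4/3)"
      by (subst sum_gp_strict) simp
    also have "\<dots> * N\<^sup>2 \<le> 4 * N\<^sup>2"
    proof (rule mult_right_mono)
      have "(1 - p) * (4/3) \<le> 4" if "0 \<le> p" for p :: real using that by simp
      from this[of "(1/4) ^ m"] show "(1 - (1/4 :: real) ^ m) * (4/3) \<le> 4"
        by (simp del: power_divide power_one_over)
    qed simp
    finally show ?thesis by (simp add: power_mult_distrib)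
  qed
  have summ: "summable (\<lambda>i. (norm (c i))\<^sup>2)"
    by (rule summableI_nonneg_bounded[OF _ partial]) simp
  then show "c \<in> ell2" by (simp add: ell2_def)
  show "ell2_norm c \<le> 2 * N"
    unfolding ell2_norm_def using suminf_le_const[OF summ partial] N by (intro real_le_lsqrt) (auto intro: suminf_nonneg summ)
  have "(\<Sum>n<m. (norm (v j n))\<^sup>2) \<le> 4 ^ j * (\<Sum>i. (norm (c i))\<^sup>2)" for m
  proof -
    have inj: "inj_on (\<lambda>n. prod_encode (j, n)) {..<m}" by (auto simp: inj_on_def)
    have "(\<Sum>n<m. (norm (v j n))\<^sup>2) = 4 ^ j * (\<Sum>n<m. ?a (j, n))"
      by (simp only: prod.case a sum_distrib_left) (simp add: power_divide)
    also have "(\<Sum>n<m. ?a (j, n)) = (\<Sum>i\<in>(\<lambda>n. prod_encode (j, n)) ` {..<m}. (norm (c i))\<^sup>2)"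
      by (simp add: sum.reindex[OF inj] cn)
    also have "\<dots> \<le> (\<Sum>i. (norm (c i))\<^sup>2)" by (intro sum_le_suminf summ) auto
    finally show ?thesis by simp
  qed
  then have "(\<Sum>n. (norm (v j n))\<^sup>2) \<le> 4 ^ j * (\<Sum>i. (norm (c i))\<^sup>2)"
    using v(1)[of j] by (intro suminf_le_const) (auto simp: ell2_def)
  then have "ell2_norm (v j) \<le> sqrt (4 ^ j * (\<Sum>i. (norm (c i))\<^sup>2))"
    by (simp add: ell2_norm_def)
  also have "\<dots> = 2 ^ j * ell2_norm c"
    by (simp add: ell2_norm_def real_sqrt_mult real_sqrt_power)
  finally show "ell2_norm (v j) \<le> 2 ^ j * ell2_norm c" .
qed

text \<open>
  Gliding hump: operators with absolutely summing constants \<open>4\<^sup>j\<close>, scaled by \<open>2\<^sup>-\<^sup>j\<close> and put on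
  disjoint coordinates, form a bounded operator that is not absolutely summing.
\<close>

lemma GT_space_uniform:
  assumes GT: "GT_space smul Y"
  obtains G where "0 \<le> G"
    "\<And>T B f b. bounded_operator_ell2 smul Y T \<Longrightarrow> (\<And>u. u \<in> Y \<Longrightarrow> ell2_norm (T u) \<le> norm u) \<Longrightarrow>
       finite B \<Longrightarrow> (\<And>k. k \<in> B \<Longrightarrow> f k \<in> Y) \<Longrightarrow>
       (\<And>\<epsilon>. (\<forall>k\<in>B. norm (\<epsilon> k) = 1) \<Longrightarrow> norm (\<Sum>k\<in>B. smul (\<epsilon> k) (f k)) \<le> b) \<Longrightarrow>
       (\<Sum>k\<in>(B :: nat set). ell2_norm (T (f k))) \<le> G * b"
proof (rule ccontr)
  define good where "good = (\<lambda>T B f b. bounded_operator_ell2 smul Y T \<and>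
    (\<forall>u\<in>Y. ell2_norm (T u) \<le> norm u) \<and> finite (B :: nat set) \<and> (\<forall>k\<in>B. f k \<in> Y) \<and>
    (\<forall>\<epsilon>. (\<forall>k\<in>B. norm (\<epsilon> k) = 1) \<longrightarrow> norm (\<Sum>k\<in>B. smul (\<epsilon> k) (f k)) \<le> b))"
  assume "\<not> thesis"
  \<comment> \<open>If \<open>4 ^ j\<close> were never exceeded, it would serve as
    \<open>G\<close>.\<close>
  have "\<exists>T B f b. good T B f b \<and> 4 ^ j * b < (\<Sum>k\<in>B. ell2_norm (T (f k)))" for j :: nat
  proof (rule ccontr)
    assume *: "\<not> ?thesis"
    have thesis
    proof (rule that[of "4 ^ j"])
      fix T B f b
      assume "bounded_operator_ell2 smul Y T" "\<And>u. u \<in> Y \<Longrightarrow> ell2_norm (T u) \<le> norm u"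
        "finite (B :: nat set)" "\<And>k. k \<in> B \<Longrightarrow> f k \<in> Y"
        "\<And>\<epsilon>. (\<forall>k\<in>B. norm (\<epsilon> k) = 1) \<Longrightarrow> norm (\<Sum>k\<in>B. smul (\<epsilon> k) (f k)) \<le> b"
      then have "good T B f b" unfolding good_def by blast
      then have "\<not> 4 ^ j * b < (\<Sum>k\<in>B. ell2_norm (T (f k)))" using * by blast
      then show "(\<Sum>k\<in>B. ell2_norm (T (f k))) \<le> 4 ^ j * b" by simp
    qed simp
    then show False using \<open>\<not> thesis\<close> by simp
  qed
  then obtain T B f b where good: "\<And>j. good (T j) (B j) (f j) (b j)"
    and big: "\<And>j. 4 ^ j * b j < (\<Sum>k\<in>B j. ell2_norm (T j (f j k)))"
    by metis
  have T: "bounded_operator_ell2 smul Y (T j)" for j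
    using good[of j] by (simp add: good_def)
  have le: "ell2_norm (T j u) \<le> norm u" if "u \<in> Y" for j u
    using good[of j] that by (simp add: good_def)
  have ell2: "T j u \<in> ell2" if "u \<in> Y" for j u
    using T[of j] that by (simp add: bounded_operator_ell2_def)
  have add: "T j (u + v) n = T j u n + T j v n" if "u \<in> Y" "v \<in> Y" for j u v n
    using T[of j] that by (simp add: bounded_operator_ell2_def)
  have scale: "T j (smul c u) n = c * T j u n" if "u \<in> Y" for j c u n
    using T[of j] that by (simp add: bounded_operator_ell2_def)
  define V where
    "V = (\<lambda>u i. case prod_decode i of (j, n) \<Rightarrow> of_real ((1/2) ^ j) * T j u n)"
  have V: "V u \<in> ell2" "ell2_norm (V u) \<le> 2 * norm u" "ell2_norm (T j u) \<le> 2 ^ j * ell2_norm (V u)"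
    if u: "u \<in> Y" for j u
    using ell2_concat[of "\<lambda>j. T j u", OF ell2[OF u] le[OF u]]
      ell2_norm_concat_le[of "\<lambda>j. T j u", OF ell2[OF u] le[OF u]]
      ell2_norm_le_concat[of "\<lambda>j. T j u", OF ell2[OF u] le[OF u]]
    unfolding V_def by blast+
  have "V (u + v) i = V u i + V v i" if "u \<in> Y" "v \<in> Y" for u v i
    unfolding V_def by (simp add: add[OF that] distrib_left split: prod.split)
  moreover have "V (smul c u) i = c * V u i" if "u \<in> Y" for c u i
    unfolding V_def by (simp add: scale[OF that] split: prod.split)
  ultimately have "bounded_operator_ell2 smul Y V"
    unfolding bounded_operator_ell2_def using V(1,2) by blast
  then have "absolutely_summing_ell2 smul Y V" using GT by (simp add: GT_space_def)
  from absolutely_summing_ell2_bound[OF this]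
  obtain C where C: "0 \<le> C" "\<And>B f b. finite B \<Longrightarrow> (\<And>k. k \<in> B \<Longrightarrow> f k \<in> Y) \<Longrightarrow>
       (\<And>\<epsilon>. (\<forall>k\<in>B. norm (\<epsilon> k) = 1) \<Longrightarrow> norm (\<Sum>k\<in>B. smul (\<epsilon> k) (f k)) \<le> b) \<Longrightarrow>
       (\<Sum>k\<in>(B :: nat set). ell2_norm (V (f k))) \<le> C * b"
    by blast
  \<comment> \<open>Undoing the damping costs \<open>2 ^ j\<close>, so the constant of
    \<open>V\<close> bounds the j-th sum by \<open>2 ^ j * C * b j\<close>; for this
    \<open>j\<close> that is at most \<open>4 ^ j * b j\<close>, against the choice of the j-th
    operator.\<close>
  obtain j where j: "C < 2 ^ j" using real_arch_pow[of 2 C] by auto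
  have g: "finite (B j)" "\<And>k. k \<in> B j \<Longrightarrow> f j k \<in> Y"
    "\<And>\<epsilon>. (\<forall>k\<in>B j. norm (\<epsilon> k) = 1) \<Longrightarrow> norm (\<Sum>k\<in>B j. smul (\<epsilon> k) (f j k)) \<le> b j"
    using good[of j] by (auto simp: good_def)
  have b0: "0 \<le> b j"
    by (rule order_trans[OF norm_ge_zero g(3)[of "\<lambda>_. 1"]]) simp
  have "4 ^ j * b j < (\<Sum>k\<in>B j. ell2_norm (T j (f j k)))" by (rule big)
  also have "\<dots> \<le> (\<Sum>k\<in>B j. 2 ^ j * ell2_norm (V (f j k)))"
    by (intro sum_mono V(3) g(2))
  also have "\<dots> = 2 ^ j * (\<Sum>k\<in>B j. ell2_norm (V (f j k)))" by (simp add: sum_distrib_left)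
  also have "\<dots> \<le> 2 ^ j * (C * b j)"
    by (intro mult_left_mono C(2) g) auto
  also have "\<dots> \<le> 2 ^ j * (2 ^ j * b j)"
    using j b0 by (intro mult_left_mono mult_right_mono) auto
  also have "\<dots> = 4 ^ j * b j" 
    using power_mult_distrib[of "2 :: real" 2 j] by simp
  finally show False by simp
qed

section \<open>Weights dominating a finite combination\<close>

text \<open>The nonnegative and the negative terms form two subsums.\<close>

lemma sum_abs_le_of_subsums:
  fixes u :: "'i \<Rightarrow> real"
  assumes "finite B" "\<And>B'. B' \<subseteq> B \<Longrightarrow> \<bar>sum u B'\<bar> \<le> M"
  shows "(\<Sum>n\<in>B. \<bar>u n\<bar>) \<le> 2 * M"
proof -
  let ?P = "{n \<in> B. 0 \<le> u n}" and ?N = "{n \<in> B. u n < 0}"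
  have "(\<Sum>n\<in>B. \<bar>u n\<bar>) = (\<Sum>n\<in>?P \<union> ?N. \<bar>u n\<bar>)"
    by (rule sum.cong) auto
  also have "\<dots> = (\<Sum>n\<in>?P. \<bar>u n\<bar>) + (\<Sum>n\<in>?N. \<bar>u n\<bar>)"
    using assms(1) by (intro sum.union_disjoint) auto
  also have "(\<Sum>n\<in>?P. \<bar>u n\<bar>) = sum u ?P" by (rule sum.cong) auto
  also have "(\<Sum>n\<in>?N. \<bar>u n\<bar>) = - sum u ?N"
    unfolding sum_negf[symmetric] by (rule sum.cong) auto
  finally show ?thesis using assms(2)[of ?P] assms(2)[of ?N] by auto
qed

context banach_over
begin

text \<open>The signs \<open>s\<close> are quantified after \<open>w\<close>: later they come from
  the coordinates of a varying vector while the weights stay fixed. Controlling all subsums, not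
  only the full one, permits the passage to absolute values.\<close>

definition sign_dominated :: "(nat \<Rightarrow> 'a) \<Rightarrow> (nat \<Rightarrow> real) \<Rightarrow> bool" where
  "sign_dominated x w \<longleftrightarrow> (\<forall>n. 0 \<le> w n) \<and>
     (\<forall>B s M. finite B \<longrightarrow> (\<forall>n\<in>B. norm (s n) = 1) \<longrightarrow>
        (\<forall>B'\<subseteq>B. norm (\<Sum>n\<in>B'. smul (s n) (x n)) \<le> M) \<longrightarrow> sum w B \<le> 8 * M)"

lemma sign_dominated_nonneg: "sign_dominated x w \<Longrightarrow> 0 \<le> w n"
  by (simp add: sign_dominated_def)

lemma sign_dominated_sum_le:
  assumes w: "sign_dominated x w" and B: "finite B" and s: "\<And>n. n \<in> B \<Longrightarrow> norm (s n) = 1"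
    and M: "\<And>B'. B' \<subseteq> B \<Longrightarrow> norm (\<Sum>n\<in>B'. smul (s n) (x n)) \<le> M"
  shows "sum w B \<le> 8 * M"
proof -
  have "\<forall>s M. (\<forall>n\<in>B. norm (s n) = 1) \<longrightarrow>
      (\<forall>B'\<subseteq>B. norm (\<Sum>n\<in>B'. smul (s n) (x n)) \<le> M) \<longrightarrow> sum w B \<le> 8 * M"
    using w B unfolding sign_dominated_def by blast
  from this[rule_format, of s M] show ?thesis using s M by simp
qed

text \<open>
  The weights are comparable with the moduli of a scalar-linear functional that norms the given
  vector, so they do not see a change of the signs \<open>s\<close>.
\<close>

lemma dominating_weights:
  fixes x :: "nat \<Rightarrow> 'a"
  assumes c: "\<And>n. n \<in> A \<Longrightarrow> norm (c n) \<le> 1"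
  obtains w where "sign_dominated x w" "norm (\<Sum>n\<in>A. smul (c n) (x n)) \<le> sum w A"
proof -
  let ?v = "\<Sum>n\<in>A. smul (c n) (x n)"
  obtain g :: "'a \<Rightarrow> real" where g: "linear g" "\<And>u. \<bar>g u\<bar> \<le> norm u" "g ?v = norm ?v"
    using norming_functional[of ?v] by metis
  obtain J :: 'k where J: "norm J \<le> 1"
    "\<And>z. \<exists>\<alpha> \<beta>. z = of_real \<alpha> + of_real \<beta> * J \<and> \<bar>\<alpha>\<bar> \<le> norm z \<and> \<bar>\<beta>\<bar> \<le> norm z"
    using real_or_complex_coordinates by metis
  \<comment> \<open>The right-hand side does not depend on \<open>z\<close>; at \<open>x n\<close>
    it becomes the weight \<open>w n\<close>.\<close>
  have g_smul: "\<bar>g (smul z y)\<bar> \<le> \<bar>g y\<bar> + \<bar>g (smul J y)\<bar>" if z: "norm z \<le> 1" for z y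
  proof -
    obtain \<alpha> \<beta> where *: "z = of_real \<alpha> + of_real \<beta> * J" "\<bar>\<alpha>\<bar> \<le> norm z" "\<bar>\<beta>\<bar> \<le> norm z"
      using J(2) by metis
    have "smul z y = \<alpha> *\<^sub>R y + \<beta> *\<^sub>R smul J y"
      unfolding *(1) scale_left_distrib scale_scale[symmetric] smul_of_real ..
    then have "g (smul z y) = \<alpha> * g y + \<beta> * g (smul J y)"
      using linear_add[OF g(1)] linear_scale[OF g(1)] by simp
    also have "\<bar>\<dots>\<bar> \<le> \<bar>\<alpha>\<bar> * \<bar>g y\<bar> + \<bar>\<beta>\<bar> * \<bar>g (smul J y)\<bar>"
      by (metis abs_mult abs_triangle_ineq)
    also have "\<dots> \<le> 1 * \<bar>g y\<bar> + 1 * \<bar>g (smul J y)\<bar>"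
      using * z by (intro add_mono mult_right_mono) auto
    finally show ?thesis by simp
  qed
  define w where "w n = \<bar>g (x n)\<bar> + \<bar>g (smul J (x n))\<bar>" for n
  show ?thesis
  proof (rule that[of w])
    have "norm ?v = (\<Sum>n\<in>A. g (smul (c n) (x n)))"
      using g(3) linear_sum[OF g(1), of "\<lambda>n. smul (c n) (x n)" A] by simp
    also have "\<dots> \<le> sum w A"
      unfolding w_def using g_smul c by (intro sum_mono) (meson abs_le_D1)
    finally show "norm ?v \<le> sum w A" .
    show "sign_dominated x w"
      unfolding sign_dominated_def
    proof (intro conjI allI impI)
      show "0 \<le> w n" for n by (simp add: w_def)
      fix B s M
      assume B: "finite B" and s: "\<forall>n\<in>B. norm (s n) = 1"
        and M: "\<forall>B'\<subseteq>B. norm (\<Sum>n\<in>B'. smul (s n) (x n)) \<le> M"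
      define y where "y n = smul (s n) (x n)" for n
      \<comment> \<open>Undoing the sign multiplies \<open>y n\<close> by
        \<open>inverse (s n)\<close>, or by \<open>J * inverse (s n)\<close> in the second term;
        both have modulus at most 1, and two uses of \<open>g_smul\<close> give the factor
        2.\<close>
      have w: "w n \<le> 2 * \<bar>g (y n)\<bar> + 2 * \<bar>g (smul J (y n))\<bar>" if "n \<in> B" for n
      proof -
        have "s n \<noteq> 0" using s that by auto
        then have x: "x n = smul (inverse (s n)) (y n)" by (simp add: y_def)
        have "smul J (x n) = smul (J * inverse (s n)) (y n)" by (subst x) simp
        moreover have "norm (inverse (s n)) \<le> 1" "norm (J * inverse (s n)) \<le> 1"
          using J(1) s that by (auto simp: norm_mult norm_inverse)
        ultimately show ?thesis
          unfolding w_def using g_smul[of "inverse (s n)" "y n"] g_smul[of "J * inverse (s n)" "y n"] x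
          by simp
      qed
      have "(\<Sum>n\<in>B. \<bar>g (y n)\<bar>) \<le> 2 * M"
      proof (rule sum_abs_le_of_subsums[OF B])
        fix B' assume "B' \<subseteq> B"
        then show "\<bar>\<Sum>n\<in>B'. g (y n)\<bar> \<le> M"
          using g(2)[of "sum y B'"] M[rule_format, of B'] linear_sum[OF g(1), of y B'] by (simp add: y_def)
      qed
      moreover have "(\<Sum>n\<in>B. \<bar>g (smul J (y n))\<bar>) \<le> 2 * M"
      proof (rule sum_abs_le_of_subsums[OF B])
        fix B' assume "B' \<subseteq> B"
        have "\<bar>\<Sum>n\<in>B'. g (smul J (y n))\<bar> = \<bar>g (smul J (sum y B'))\<bar>"
          using linear_sum[OF g(1), of "\<lambda>n. smul J (y n)" B'] by (simp add: scale_sum_right)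
        also have "\<dots> \<le> norm J * norm (sum y B')" using g(2) by (metis norm_smul)
        also have "\<dots> \<le> 1 * norm (sum y B')" using J(1) by (intro mult_right_mono) auto
        also have "\<dots> \<le> M" using M[rule_format, OF \<open>B' \<subseteq> B\<close>] by (simp add: y_def)
        finally show "\<bar>\<Sum>n\<in>B'. g (smul J (y n))\<bar> \<le> M" .
      qed
      \<comment> \<open>The 8 is 2 * 2 from \<open>g\<close> plus 2 * 2 from its composition with
        \<open>J\<close>.\<close>
      ultimately show "sum w B \<le> 8 * M"
        using sum_mono[OF w, of B "\<lambda>n. n"] by (simp add: sum.distrib flip: sum_distrib_left)
    qed
  qed
qed

end

section \<open>Truncations and the a priori estimate\<close>

text \<open>If \<open>y\<close> exceeds \<open>(1/4) ^ J\<close>, the first \<open>j\<close> with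
  \<open>(1/4) ^ Suc j \<le> y\<close> already contributes \<open>(1/4) ^ j \<ge> y\<close>. The
  threshold is one power smaller than the coefficient.\<close>

lemma le_dyadic_sum:
  fixes y :: real
  assumes "y \<le> 1"
  shows "y \<le> (1/4) ^ J + (\<Sum>j<J. (1/4) ^ j * (if (1/4) ^ Suc j \<le> y then 1 else 0))"
proof -
  define q where "q j = (1/4 :: real) ^ j" for j
  define d where "d j = q j * (if q (Suc j) \<le> y then 1 else 0)" for j
  have q: "0 \<le> q j" for j by (simp add: q_def)
  then have d: "0 \<le> sum d {..<j}" for j by (intro sum_nonneg) (simp add: d_def)
  have "y \<le> q J + sum d {..<J}"
  proof (induction J)
    case 0
    then show ?case using assms by (simp add: q_def)
  next
    case (Suc J)
    show ?case
    proof (cases "q (Suc J) \<le> y")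
      case True
      then have "sum d {..<Suc J} = sum d {..<J} + q J" by (simp add: d_def)
      then show ?thesis using Suc q[of "Suc J"] by linarith
    next
      case False
      then show ?thesis using d[of "Suc J"] by linarith
    qed
  qed
  then show ?thesis unfolding d_def q_def .
qed

text \<open>The strict inequality provides a real admissible constant below \<open>D\<close>, so
  attainment of the infimum is not an issue.\<close>

lemma norm_restricted_truncation_le:
  assumes "nearly_tqg_function smul x xs a < ereal D" and "f \<in> unit_coordinates xs"
  shows "norm (restricted_truncation smul x xs a f) \<le> D * norm f"
proof -
  obtain C where "C < D" "norm (restricted_truncation smul x xs a f) \<le> C * norm f"
    using assms by (auto simp: nearly_tqg_function_def Inf_less_iff)
  moreover have "C * norm f \<le> D * norm f" using \<open>C < D\<close> by (intro mult_right_mono) auto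
  ultimately show ?thesis by simp
qed

text \<open>For the least \<open>J\<close> with \<open>E \<le> 4 ^ J\<close>, the previous power
  lies below \<open>E\<close>; for J = 0 the second bound rests on \<open>1 \<le> E\<close>.\<close>

lemma exists_power4_between:
  fixes E :: real
  assumes "1 \<le> E"
  obtains J :: nat where "E \<le> 4 ^ J" "2 ^ J \<le> 2 * sqrt E"
proof -
  define J where "J = (LEAST J. E \<le> 4 ^ J)"
  obtain n where "E < 4 ^ n" using real_arch_pow[of 4 E] by auto
  then have "E \<le> 4 ^ n" by simp
  then have J: "E \<le> 4 ^ J" unfolding J_def by (rule LeastI[where P = "\<lambda>J. E \<le> 4 ^ J"])
  have "2 ^ J \<le> 2 * sqrt E"
  proof (cases J)
    case 0
    have "1 \<le> sqrt E" using assms by simp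
    then have "1 \<le> 2 * sqrt E" by linarith
    then show ?thesis by (simp only: 0 power_0)
  next
    case (Suc i)
    then have "i < J" by simp
    then have "\<not> E \<le> 4 ^ i" unfolding J_def by (rule not_less_Least)
    moreover have "(4 :: real) ^ i = (2 ^ i)\<^sup>2"
      using power_mult_distrib[of "2 :: real" 2 i] by (simp add: power2_eq_square)
    ultimately have "2 ^ i \<le> sqrt E" by (intro real_le_rsqrt) simp
    then show ?thesis using Suc by simp
  qed
  then show ?thesis using J that by blast
qed

section \<open>Coordinates with respect to a bounded basis\<close>

locale bounded_basis = banach_over smul
  for smul :: "'k::real_or_complex \<Rightarrow> 'a::banach \<Rightarrow> 'a" +
  fixes x :: "nat \<Rightarrow> 'a" and xs :: "nat \<Rightarrow> 'a \<Rightarrow>\<^sub>L 'k" and L :: real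
  assumes basis: "basis smul x xs"
    and norm_x: "norm (x n) \<le> L" and norm_xs: "norm (xs n) \<le> L" and L_ge_1: "1 \<le> L"
begin

lemma L_pos: "0 < L"
  using L_ge_1 by simp

lemma xs_in_dual: "xs n \<in> dual_space smul"
  using basis by (simp add: basis_def)

lemma coord_smul [simp]: "xs n (smul c v) = c * xs n v"
  using xs_in_dual[of n] by (simp add: dual_space_def)

lemma coord_x [simp]: "xs m (x n) = (if m = n then 1 else 0)"
  using basis by (simp add: basis_def)

lemma coord_sum:
  assumes "finite A"
  shows "xs m (\<Sum>n\<in>A. smul (c n) (x n)) = (if m \<in> A then c m else 0)"
proof -
  have "xs m (\<Sum>n\<in>A. smul (c n) (x n)) = (\<Sum>n\<in>A. c n * (if m = n then 1 else 0))"
    by (simp add: blinfun.sum_right)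
  also have "\<dots> = (\<Sum>n\<in>A. if m = n then c n else 0)" by (rule sum.cong) auto
  finally show ?thesis using assms by (simp add: sum.delta')
qed

lemma norm_coord_le: "norm (xs n f) \<le> L * norm f"
  by (rule order_trans[OF norm_blinfun]) (intro mult_right_mono norm_xs norm_ge_zero)

lemma norm_sum_le:
  assumes "\<And>n. n \<in> A \<Longrightarrow> norm (c n) \<le> 1"
  shows "norm (\<Sum>n\<in>A. smul (c n) (x n)) \<le> real (card A) * L"
proof (rule sum_norm_bound)
  fix n assume "n \<in> A"
  then have "norm (c n) * norm (x n) \<le> 1 * L"
    using assms norm_x by (intro mult_mono) auto
  then show "norm (smul (c n) (x n)) \<le> L" by (simp add: norm_smul)
qed

lemma span_approx:
  assumes "0 < e"
  obtains g where "g \<in> span (range x)" "norm (f - g) < e"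
proof -
  have "f \<in> closure (span (range x))" using basis by (simp add: basis_def)
  then obtain g where "g \<in> span (range x)" "dist g f < e"
    using assms by (auto simp: closure_approachable)
  then show ?thesis using that by (simp add: dist_norm norm_minus_commute)
qed

lemma coord_span_eventually_zero:
  assumes "g \<in> span (range x)"
  shows "\<forall>\<^sub>F n in sequentially. xs n g = 0"
proof -
  let ?S = "{g. \<forall>\<^sub>F n in sequentially. xs n g = 0}"
  have "subspace ?S"
  proof (rule subspaceI)
    show "g + h \<in> ?S" if "g \<in> ?S" "h \<in> ?S" for g h
      using eventually_conj[of "\<lambda>n. xs n g = 0" sequentially "\<lambda>n. xs n h = 0"] that
      by (auto simp: blinfun.add_right elim!: eventually_mono)
    show "smul c g \<in> ?S" if "g \<in> ?S" for c g
      using that by (auto elim: eventually_mono)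
  qed simp
  moreover have "range x \<subseteq> ?S"
  proof (rule image_subsetI, rule CollectI)
    show "\<forall>\<^sub>F n in sequentially. xs n (x m) = 0" for m
      using eventually_gt_at_top[of m] by (rule eventually_mono) simp
  qed
  ultimately have "span (range x) \<subseteq> ?S" by (rule span_minimal[rotated])
  then show ?thesis using assms by blast
qed

text \<open>On the dense span the coordinates vanish eventually, and the functionals are uniformly
  bounded. This makes the sets of large coordinates finite and puts coordinate sequences into
  \<open>c0\<close>.\<close>

lemma coord_tendsto_zero: "(\<lambda>n. xs n f) \<longlonglongrightarrow> 0"
proof (rule tendstoI)
  fix e :: real assume "0 < e"
  then have "0 < e / L" using L_pos by simp
  then obtain g where g: "g \<in> span (range x)" "norm (f - g) < e / L"
    by (rule span_approx)
  show "\<forall>\<^sub>F n in sequentially. dist (xs n f) 0 < e"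
    using coord_span_eventually_zero[OF g(1)]
  proof eventually_elim
    case (elim n)
    then have "xs n f = xs n (f - g)" by (simp add: blinfun.diff_right)
    then show ?case
      using norm_coord_le[of n "f - g"] g(2) L_pos by (simp add: field_simps)
  qed
qed

lemma finite_large_coordinates:
  assumes "0 < a"
  shows "finite (large_coordinates xs a f)"
proof -
  obtain N where "\<And>n. n \<ge> N \<Longrightarrow> norm (xs n f) < a"
    using tendstoD[OF coord_tendsto_zero assms, of f] by (auto simp: eventually_sequentially)
  then have "n < N" if "n \<in> large_coordinates xs a f" for n
    using that by (cases "n < N") (auto simp: large_coordinates_def not_le[symmetric])
  then have "large_coordinates xs a f \<subseteq> {..<N}" by blast
  then show ?thesis by (rule finite_subset) simp
qed

section \<open>Estimates on the level sets of the coordinates\<close>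

text \<open>The signed sum over all large coordinates has coordinates of modulus 0 or 1, so near
  unconditionality at the single level 1/2 passes from it to the part on \<open>B\<close>. The
  minimum in the truncation is at least \<open>a\<close>, whence the factor on the left.\<close>

lemma norm_sign_sum_le:
  assumes C: "0 \<le> C" "\<And>f A. f \<in> unit_coordinates xs \<Longrightarrow> A \<subseteq> large_coordinates xs (1/2) f \<Longrightarrow>
      norm (coordinate_projection smul x xs A f) \<le> C * norm f"
    and a: "0 < a" and B: "B \<subseteq> large_coordinates xs a f"
  shows "a * norm (\<Sum>n\<in>B. smul (sgn (xs n f)) (x n))
    \<le> C * norm (restricted_truncation smul x xs a f)"
proof (cases "large_coordinates xs a f = {}")
  case True
  then show ?thesis using B C(1) by simp
next
  case False
  let ?A = "large_coordinates xs a f"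
  define g where "g = (\<Sum>n\<in>?A. smul (sgn (xs n f)) (x n))"
  have fin: "finite ?A" using a by (rule finite_large_coordinates)
  have g: "xs m g = (if m \<in> ?A then sgn (xs m f) else 0)" for m
    unfolding g_def using fin by (rule coord_sum)
  have "g \<in> unit_coordinates xs" by (simp add: unit_coordinates_def g norm_sgn)
  moreover have "norm (xs m g) = 1" if "m \<in> ?A" for m
    using that a by (auto simp: g norm_sgn large_coordinates_def)
  then have "B \<subseteq> large_coordinates xs (1/2) g"
    using B by (auto simp: large_coordinates_def[of _ "1/2"])
  ultimately have "norm (coordinate_projection smul x xs B g) \<le> C * norm g"
    by (rule C(2))
  moreover have "coordinate_projection smul x xs B g = (\<Sum>n\<in>B. smul (sgn (xs n f)) (x n))"
    unfolding coordinate_projection_def by (rule sum.cong) (use B in \<open>auto simp: g\<close>)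
  ultimately have 1: "norm (\<Sum>n\<in>B. smul (sgn (xs n f)) (x n)) \<le> C * norm g" by simp
  let ?m = "Min ((\<lambda>n. norm (xs n f)) ` ?A)"
  have "a \<le> ?m" using fin False by (auto simp: large_coordinates_def)
  then have "a * norm g \<le> norm (restricted_truncation smul x xs a f)"
    using False a by (simp add: restricted_truncation_def g_def[symmetric] Let_def mult_right_mono)
  then have "C * (a * norm g) \<le> C * norm (restricted_truncation smul x xs a f)"
    using C(1) by (rule mult_left_mono)
  moreover have "a * norm (\<Sum>n\<in>B. smul (sgn (xs n f)) (x n)) \<le> a * (C * norm g)"
    using 1 a by simp
  ultimately show ?thesis by (simp add: mult.left_commute)
qed

text \<open>Testing \<open>u\<close> on suitably rotated coefficients bounds the l1 sum of the
  \<open>u (x n)\<close> by \<open>norm u * \<Phi>\<close>; each term is at most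
  \<open>norm u * L\<close>, and the product of the two bounds the squares.\<close>

lemma sum_norm_functional_square_le:
  assumes \<Phi>: "\<And>c. (\<And>n. n \<in> A \<Longrightarrow> norm (c n) \<le> 1) \<Longrightarrow> norm (\<Sum>n\<in>A. smul (c n) (x n)) \<le> \<Phi>"
    and u: "u \<in> dual_space smul"
  shows "(\<Sum>n\<in>A. (norm (u (x n)))\<^sup>2) \<le> L * \<Phi> * (norm u)\<^sup>2"
proof -
  \<comment> \<open>Where \<open>u (x n)\<close> vanishes, \<open>inverse 0 = 0\<close> makes the
    coefficient 0, which is still admissible.\<close>
  define c where "c n = inverse (sgn (u (x n)))" for n
  have c: "c n * u (x n) = of_real (norm (u (x n)))" for n
    by (cases "u (x n) = 0") (auto simp: c_def sgn_div_norm scaleR_conv_of_real field_simps)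
  have "norm (c n) \<le> 1" for n by (simp add: c_def norm_inverse norm_sgn)
  then have "norm (\<Sum>n\<in>A. smul (c n) (x n)) \<le> \<Phi>" by (intro \<Phi>)
  then have bound: "norm u * norm (\<Sum>n\<in>A. smul (c n) (x n)) \<le> norm u * \<Phi>"
    by (rule mult_left_mono) simp
  have "u (\<Sum>n\<in>A. smul (c n) (x n)) = (\<Sum>n\<in>A. c n * u (x n))"
    using u by (simp add: blinfun.sum_right dual_space_def)
  also have "\<dots> = of_real (\<Sum>n\<in>A. norm (u (x n)))" by (simp add: c)
  finally have "norm (of_real (\<Sum>n\<in>A. norm (u (x n))) :: 'k) \<le> norm u * \<Phi>"
    using norm_blinfun[of u "\<Sum>n\<in>A. smul (c n) (x n)"] bound by simp
  then have l1: "(\<Sum>n\<in>A. norm (u (x n))) \<le> norm u * \<Phi>"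
    unfolding norm_of_real by simp
  have "(\<Sum>n\<in>A. (norm (u (x n)))\<^sup>2) \<le> (\<Sum>n\<in>A. (norm u * L) * norm (u (x n)))"
  proof (rule sum_mono)
    fix n
    have "norm (u (x n)) \<le> norm u * L"
      by (rule order_trans[OF norm_blinfun]) (intro mult_left_mono norm_x norm_ge_zero)
    then show "(norm (u (x n)))\<^sup>2 \<le> (norm u * L) * norm (u (x n))"
      by (simp add: power2_eq_square mult_right_mono)
  qed
  also have "\<dots> = (norm u * L) * (\<Sum>n\<in>A. norm (u (x n)))" by (simp add: sum_distrib_left)
  also have "\<dots> \<le> (norm u * L) * (norm u * \<Phi>)"
    using l1 L_pos by (intro mult_left_mono) auto
  finally show ?thesis by (simp add: power2_eq_square ac_simps)
qed

text \<open>Sign domination, with the signs of the coordinates of \<open>f\<close>, bounds the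
  weight of the j-th level set by a multiple of \<open>8 ^ j\<close>; the coefficient 4^-j turns
  this into \<open>2 ^ j\<close>. Coordinates below the last level are charged to the total weight.
  \<open>J\<close> stays free for a later choice.\<close>

lemma weighted_coord_sum_le:
  assumes H: "0 \<le> H" "\<And>j B. B \<subseteq> large_coordinates xs ((1/4) ^ Suc j) f \<Longrightarrow>
      norm (\<Sum>n\<in>B. smul (sgn (xs n f)) (x n)) \<le> H * 8 ^ j * norm f"
    and f: "f \<in> unit_coordinates xs"
    and w: "sign_dominated x w"
    and A: "finite A"
  shows "(\<Sum>n\<in>A. w n * norm (xs n f)) \<le> (1/4) ^ J * sum w A + 8 * H * norm f * 2 ^ J"
proof -
  define B where "B j = {n \<in> A. (1/4) ^ Suc j \<le> norm (xs n f)}" for j :: nat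
  have B: "sum w (B j) \<le> 8 * (H * 8 ^ j * norm f)" for j
  proof (rule sign_dominated_sum_le[OF w])
    show "finite (B j)" using A by (simp add: B_def)
    have pos: "(0 :: real) < (1/4) ^ Suc j" by (rule zero_less_power) simp
    show "norm (sgn (xs n f)) = 1" if "n \<in> B j" for n
    proof -
      have "(1/4) ^ Suc j \<le> norm (xs n f)" using that unfolding B_def by blast
      with pos have "0 < norm (xs n f)" by (rule less_le_trans)
      then show ?thesis by (simp add: norm_sgn)
    qed
    show "norm (\<Sum>n\<in>B'. smul (sgn (xs n f)) (x n)) \<le> H * 8 ^ j * norm f" if "B' \<subseteq> B j" for B'
      using that by (intro H(2)) (auto simp only: B_def large_coordinates_def)
  qed
  have level: "(1/4) ^ j * sum w (B j) \<le> 8 * H * norm f * 2 ^ j" for j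
  proof -
    have "(1/4) ^ j * sum w (B j) \<le> (1/4) ^ j * (8 * (H * 8 ^ j * norm f))"
      by (intro mult_left_mono B) simp
    also have "\<dots> = 8 * H * norm f * ((1/4) ^ j * 8 ^ j)" by (simp only: ac_simps)
    also have "(1/4 :: real) ^ j * 8 ^ j = 2 ^ j"
      using power_mult_distrib[of "1/4 :: real" 8 j] by simp
    finally show ?thesis .
  qed
  have "(\<Sum>n\<in>A. w n * norm (xs n f)) \<le>
      (\<Sum>n\<in>A. w n * ((1/4) ^ J + (\<Sum>j<J. (1/4) ^ j * (if (1/4) ^ Suc j \<le> norm (xs n f) then 1 else 0))))"
    using f sign_dominated_nonneg[OF w] by (intro sum_mono mult_left_mono le_dyadic_sum) (auto simp: unit_coordinates_def)
  also have "\<dots> = (1/4) ^ J * sum w A +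
      (\<Sum>n\<in>A. \<Sum>j<J. (1/4) ^ j * (w n * (if (1/4) ^ Suc j \<le> norm (xs n f) then 1 else 0)))"
    by (simp only: distrib_left sum.distrib sum_distrib_left sum_distrib_right ac_simps)
  also have "(\<Sum>n\<in>A. \<Sum>j<J. (1/4) ^ j * (w n * (if (1/4) ^ Suc j \<le> norm (xs n f) then 1 else 0)))
      = (\<Sum>j<J. (1/4) ^ j * (\<Sum>n\<in>A. w n * (if (1/4) ^ Suc j \<le> norm (xs n f) then 1 else 0)))"
    unfolding sum_distrib_left by (rule sum.swap)
  also have "\<dots> = (\<Sum>j<J. (1/4) ^ j * sum w (B j))"
  proof (rule sum.cong[OF refl])
    fix j
    have "(\<Sum>n\<in>A. w n * (if (1/4) ^ Suc j \<le> norm (xs n f) then 1 else 0))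
      = (\<Sum>n\<in>A. if (1/4) ^ Suc j \<le> norm (xs n f) then w n else 0)"
      by (rule sum.cong) auto
    also have "\<dots> = sum w (B j)" unfolding B_def by (rule sum.inter_filter[symmetric, OF A])
    finally show "(1/4) ^ j * (\<Sum>n\<in>A. w n * (if (1/4) ^ Suc j \<le> norm (xs n f) then 1 else 0))
      = (1/4) ^ j * sum w (B j)" by (simp only:)
  qed
  also have "\<dots> \<le> (\<Sum>j<J. 8 * H * norm f * 2 ^ j)" by (intro sum_mono level)
  also have "\<dots> = 8 * H * norm f * (\<Sum>j<J. 2 ^ j)" by (simp only: sum_distrib_left)
  also have "(\<Sum>j<J. 2 ^ j) = (2 :: real) ^ J - 1" by (simp add: sum_gp_strict)
  also have "8 * H * norm f * (2 ^ J - 1) \<le> 8 * H * norm f * 2 ^ J"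
    using H(1) by (intro mult_left_mono) auto
  finally show ?thesis by simp
qed

text \<open>This bounds the supremum on the right of the summing inequality: taking absolute values
  removes the unimodular factors and leaves a weighted coordinate sum.\<close>

lemma norm_signed_coord_sum_le:
  assumes H: "0 \<le> H" "\<And>f j B. f \<in> unit_coordinates xs \<Longrightarrow> B \<subseteq> large_coordinates xs ((1/4) ^ Suc j) f \<Longrightarrow>
      norm (\<Sum>n\<in>B. smul (sgn (xs n f)) (x n)) \<le> H * 8 ^ j * norm f"
    and w: "sign_dominated x w"
    and A: "finite A" and \<epsilon>: "\<And>n. n \<in> A \<Longrightarrow> norm (\<epsilon> n) = 1"
  shows "norm (\<Sum>n\<in>A. dual_scale (\<epsilon> n) (dual_scale (of_real (w n)) (xs n)))
    \<le> L * (1/4) ^ J * sum w A + 8 * H * 2 ^ J" (is "_ \<le> ?b")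
proof (rule norm_blinfun_bound)
  have "0 \<le> sum w A" by (intro sum_nonneg sign_dominated_nonneg[OF w])
  then show "0 \<le> ?b" using H(1) L_pos by simp
  fix u
  have "norm ((\<Sum>n\<in>A. dual_scale (\<epsilon> n) (dual_scale (of_real (w n)) (xs n))) u)
      = norm (\<Sum>n\<in>A. \<epsilon> n * (of_real (w n) * xs n u))"
    by (simp add: blinfun.sum_left)
  also have "\<dots> \<le> (\<Sum>n\<in>A. w n * norm (xs n u))"
    using \<epsilon> sign_dominated_nonneg[OF w] by (intro sum_norm_le) (simp add: norm_mult)
  also have "\<dots> \<le> ?b * norm u"
  proof (cases "u = 0")
    case True
    then show ?thesis by simp
  next
    case False
    \<comment> \<open>Scaling to norm \<open>1 / L\<close> puts \<open>f\<close> into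
      \<open>unit_coordinates\<close>. Scaling back leaves \<open>L\<close> only in the first term,
      since the second carries \<open>norm f\<close>.\<close>
    define r where "r = L * norm u"
    have r: "0 < r" using False L_pos by (simp add: r_def)
    define f where "f = inverse r *\<^sub>R u"
    have u: "u = r *\<^sub>R f" using r by (simp add: f_def)
    have f: "norm f = 1 / L" using False L_pos by (simp add: f_def r_def field_simps)
    have "norm (xs n f) \<le> 1" for n using norm_coord_le[of n f] f L_pos by simp
    then have "f \<in> unit_coordinates xs" by (simp add: unit_coordinates_def)
    then have "(\<Sum>n\<in>A. w n * norm (xs n f)) \<le> (1/4) ^ J * sum w A + 8 * H * norm f * 2 ^ J"
      by (intro weighted_coord_sum_le[OF H(1) H(2) _ w A]) auto
    then have "r * (\<Sum>n\<in>A. w n * norm (xs n f)) \<le> r * ((1/4) ^ J * sum w A + 8 * H * norm f * 2 ^ J)"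
      using r by (intro mult_left_mono) auto
    also have "\<dots> = ?b * norm u"
      using L_pos by (simp only: f) (simp add: r_def field_simps)
    also have "r * (\<Sum>n\<in>A. w n * norm (xs n f)) = (\<Sum>n\<in>A. w n * norm (xs n u))"
      using r by (simp add: u blinfun.scaleR_right sum_distrib_left ac_simps)
    finally show ?thesis .
  qed
  finally show "norm ((\<Sum>n\<in>A. dual_scale (\<epsilon> n) (dual_scale (of_real (w n)) (xs n))) u)
    \<le> ?b * norm u" .
qed

section \<open>Application of the GT property\<close>

text \<open>Division by \<open>r\<close> makes the operator a contraction, as the uniform GT
  constant requires. By biorthogonality a multiple of \<open>xs n\<close> is sent to a sequence with
  one possibly nonzero entry.\<close>

lemma bounded_operator_coordinates:
  assumes r: "0 < r" and A: "finite A"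
    and T: "\<forall>u\<in>dual_space smul. (\<Sum>n\<in>A. (norm (blinfun_apply u (x n)))\<^sup>2) \<le> r\<^sup>2 * (norm u)\<^sup>2"
  defines "T \<equiv> \<lambda>u n. if n \<in> A then of_real (inverse r) * blinfun_apply u (x n) else 0"
  shows "bounded_operator_ell2 dual_scale (dual_space smul) T"
    and "\<And>u. u \<in> dual_space smul \<Longrightarrow> ell2_norm (T u) \<le> norm u"
    and "\<And>n c. n \<in> A \<Longrightarrow> ell2_norm (T (dual_scale c (xs n))) = norm c / r"
proof -
  have suminf: "(\<Sum>n. (norm (T u n))\<^sup>2) = (\<Sum>n\<in>A. (norm (T u n))\<^sup>2)" for u
    by (rule suminf_finite[OF A]) (simp add: T_def)
  have ell2: "T u \<in> ell2" for u
    unfolding ell2_def by (intro CollectI summable_finite[OF A]) (simp add: T_def)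
  show le: "ell2_norm (T u) \<le> norm u" if "u \<in> dual_space smul" for u
  proof -
    have "(\<Sum>n\<in>A. (norm (T u n))\<^sup>2) = inverse (r\<^sup>2) * (\<Sum>n\<in>A. (norm (u (x n)))\<^sup>2)"
      using r by (simp add: T_def norm_mult norm_inverse power_mult_distrib power_inverse sum_distrib_left)
    also have "\<dots> \<le> inverse (r\<^sup>2) * (r\<^sup>2 * (norm u)\<^sup>2)"
      using T that by (intro mult_left_mono) auto
    also have "\<dots> = (norm u)\<^sup>2" using r by simp
    finally show ?thesis unfolding ell2_norm_def suminf by (intro real_le_lsqrt) (auto intro: sum_nonneg)
  qed
  show "bounded_operator_ell2 dual_scale (dual_space smul) T"
    unfolding bounded_operator_ell2_def
  proof (intro conjI ballI allI)
    show "\<exists>M. \<forall>u\<in>dual_space smul. ell2_norm (T u) \<le> M * norm u"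
      using le by (intro exI[of _ 1]) simp
  qed (simp_all add: ell2, simp_all add: T_def blinfun.add_left distrib_left)
  show "ell2_norm (T (dual_scale c (xs n))) = norm c / r" if "n \<in> A" for n c
  proof -
    have "(\<Sum>m\<in>A. (norm (T (dual_scale c (xs n)) m))\<^sup>2) = (\<Sum>m\<in>A. if n = m then (norm c / r)\<^sup>2 else 0)"
      using r by (intro sum.cong) (auto simp: T_def norm_mult norm_inverse divide_inverse)
    also have "\<dots> = (norm c / r)\<^sup>2" using A that by simp
    finally show ?thesis using r by (simp add: ell2_norm_def suminf)
  qed
qed

text \<open>The operators vary with \<open>A\<close>, so a constant common to all contractions is
  needed for a bound independent of \<open>A\<close>. For fixed \<open>A\<close> the supremum is
  finite by cardinality, which permits dividing the self-bounding inequality.\<close>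

lemma sums_uniformly_bounded:
  assumes GT: "GT_space dual_scale (dual_space smul)"
    and H: "0 \<le> H" "\<And>f j B. f \<in> unit_coordinates xs \<Longrightarrow> B \<subseteq> large_coordinates xs ((1/4) ^ Suc j) f \<Longrightarrow>
      norm (\<Sum>n\<in>B. smul (sgn (xs n f)) (x n)) \<le> H * 8 ^ j * norm f"
  obtains M where "\<And>A c. finite A \<Longrightarrow> (\<And>n. n \<in> A \<Longrightarrow> norm (c n) \<le> 1) \<Longrightarrow>
      norm (\<Sum>n\<in>A. smul (c n) (x n)) \<le> M"
proof -
  from GT_space_uniform[OF GT] obtain G where G: "0 \<le> G"
    "\<And>T B f b. bounded_operator_ell2 dual_scale (dual_space smul) T \<Longrightarrow>
       (\<And>u. u \<in> dual_space smul \<Longrightarrow> ell2_norm (T u) \<le> norm u) \<Longrightarrow>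
       finite B \<Longrightarrow> (\<And>k. k \<in> B \<Longrightarrow> f k \<in> dual_space smul) \<Longrightarrow>
       (\<And>\<epsilon>. (\<forall>k\<in>B. norm (\<epsilon> k) = 1) \<Longrightarrow> norm (\<Sum>k\<in>B. dual_scale (\<epsilon> k) (f k)) \<le> b) \<Longrightarrow>
       (\<Sum>k\<in>(B :: nat set). ell2_norm (T (f k))) \<le> G * b"
    by blast
  define q where "q = G * sqrt L"
  \<comment> \<open>The 32 is 16, from absorbing half of the total weight, times the 2 in the bound
    for \<open>2 ^ J\<close>.\<close>
  define Z where "Z = 32 * H * q * sqrt (2 * q * L + 1)"
  have q: "0 \<le> q" using G(1) L_pos by (simp add: q_def)
  show ?thesis
  proof (rule that[of "(max 1 Z) ^ 4"])
    fix A :: "nat set" and c0 :: "nat \<Rightarrow> 'k"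
    assume A: "finite A" and c0: "\<And>n. n \<in> A \<Longrightarrow> norm (c0 n) \<le> 1"
    define S where "S = (\<lambda>c. norm (\<Sum>n\<in>A. smul (c n) (x n))) ` {c. \<forall>n\<in>A. norm (c n) \<le> 1}"
    have bdd: "bdd_above S"
      unfolding S_def by (rule bdd_aboveI[of _ "real (card A) * L"]) (auto intro: norm_sum_le)
    \<comment> \<open>The maximum with 1 gives \<open>1 \<le> s\<close> below, so that additive
      constants can be absorbed into powers of \<open>s\<close>.\<close>
    define \<Phi> where "\<Phi> = max 1 (Sup S)"
    have \<Phi>: "norm (\<Sum>n\<in>A. smul (c n) (x n)) \<le> \<Phi>" if "\<And>n. n \<in> A \<Longrightarrow> norm (c n) \<le> 1" for c
    proof -
      have "norm (\<Sum>n\<in>A. smul (c n) (x n)) \<in> S" using that by (auto simp: S_def)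
      from cSup_upper[OF this bdd] show ?thesis by (simp add: \<Phi>_def)
    qed
    \<comment> \<open>With the fourth root, all fractional powers of \<open>\<Phi>\<close> become
      integer powers of \<open>s\<close>.\<close>
    define s where "s = sqrt (sqrt \<Phi>)"
    have \<Phi>1: "1 \<le> \<Phi>" by (simp add: \<Phi>_def)
    then have s: "1 \<le> s" by (simp add: s_def)
    have s2: "s\<^sup>2 = sqrt \<Phi>" using \<Phi>1 by (simp add: s_def)
    have s4: "s ^ 4 = \<Phi>"
    proof -
      have "s ^ 4 = (s\<^sup>2)\<^sup>2" by (simp flip: power_mult)
      then show ?thesis using \<Phi>1 by (simp add: s2)
    qed
    define r where "r = sqrt L * s\<^sup>2"
    have r: "0 < r" using L_pos s by (simp add: r_def)
    have r2: "r\<^sup>2 = L * \<Phi>" using L_pos \<Phi>1 by (simp add: r_def s2 power_mult_distrib)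
    have square: "\<forall>u\<in>dual_space smul. (\<Sum>n\<in>A. (norm (blinfun_apply u (x n)))\<^sup>2) \<le> r\<^sup>2 * (norm u)\<^sup>2"
      unfolding r2 by (intro ballI sum_norm_functional_square_le \<Phi>)
    note T = bounded_operator_coordinates[OF r A square]
    have bound: "norm (\<Sum>n\<in>A. smul (c n) (x n)) \<le> Z * s ^ 3"
      if c: "\<And>n. n \<in> A \<Longrightarrow> norm (c n) \<le> 1" for c
    proof -
      obtain w where w: "sign_dominated x w" "norm (\<Sum>n\<in>A. smul (c n) (x n)) \<le> sum w A"
        using dominating_weights[of A c x, OF c] by blast
      note w_nonneg = sign_dominated_nonneg[OF w(1)]
      \<comment> \<open>The contraction sends \<open>w n\<close> times \<open>xs n\<close> to a
        sequence of norm \<open>w n / r\<close>, so the summing inequality bounds the total weight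
        by itself.\<close>
      have P: "sum w A \<le> r * (G * (L * (1/4) ^ J * sum w A + 8 * H * 2 ^ J))" for J
      proof -
        have "(\<Sum>n\<in>A. w n / r) \<le> G * (L * (1/4) ^ J * sum w A + 8 * H * 2 ^ J)"
        proof -
          have "(\<Sum>n\<in>A. ell2_norm (\<lambda>m. if m \<in> A then of_real (inverse r) *
              dual_scale (of_real (w n)) (xs n) (x m) else 0))
            \<le> G * (L * (1/4) ^ J * sum w A + 8 * H * 2 ^ J)"
          proof (rule G(2)[OF T(1,2) A])
            show "dual_scale (of_real (w n)) (xs n) \<in> dual_space smul" for n
              by (simp add: dual_space_def)
            show "norm (\<Sum>n\<in>A. dual_scale (\<epsilon> n) (dual_scale (of_real (w n)) (xs n)))
                \<le> L * (1/4) ^ J * sum w A + 8 * H * 2 ^ J" if "\<forall>n\<in>A. norm (\<epsilon> n) = 1" for \<epsilon>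
              using that by (intro norm_signed_coord_sum_le[OF H w(1) A]) auto
          qed auto
          moreover have "(\<Sum>n\<in>A. ell2_norm (\<lambda>m. if m \<in> A then of_real (inverse r) *
              dual_scale (of_real (w n)) (xs n) (x m) else 0)) = (\<Sum>n\<in>A. w n / r)"
            using w_nonneg by (intro sum.cong refl) (simp add: T(3))
          ultimately show ?thesis by simp
        qed
        then have "sum w A / r \<le> G * (L * (1/4) ^ J * sum w A + 8 * H * 2 ^ J)"
          by (simp add: sum_divide_distrib)
        then show ?thesis using r by (simp add: field_simps)
      qed
      have rG: "r * G = q * s\<^sup>2" by (simp add: r_def q_def)
      have q0: "0 \<le> q * s\<^sup>2" using q by simp
      have "1 \<le> 2 * (q * s\<^sup>2) * L + 1" using q0 L_pos by simp
      \<comment> \<open>The lower bound makes the coefficient of \<open>sum w A\<close> on the right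
        at most 1/2, so that it is absorbed; the upper bound keeps \<open>2 ^ J\<close> of order
        \<open>s\<close>.\<close>
      then obtain J where J: "2 * (q * s\<^sup>2) * L + 1 \<le> 4 ^ J"
        "2 ^ J \<le> 2 * sqrt (2 * (q * s\<^sup>2) * L + 1)"
        by (rule exists_power4_between)
      have w0: "0 \<le> sum w A" using w_nonneg by (intro sum_nonneg)
      have "q * s\<^sup>2 * L * (1/4) ^ J \<le> 1/2"
        using J(1) by (simp add: power_divide field_simps)
      then have half: "q * s\<^sup>2 * L * (1/4) ^ J * sum w A \<le> 1/2 * sum w A"
        using w0 by (rule mult_right_mono)
      have "sum w A \<le> q * s\<^sup>2 * (L * (1/4) ^ J * sum w A + 8 * H * 2 ^ J)"
        using P[of J] by (simp only: mult.assoc[symmetric] rG)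
      also have "\<dots> = q * s\<^sup>2 * L * (1/4) ^ J * sum w A + 8 * H * (q * s\<^sup>2) * 2 ^ J"
        by (simp only: distrib_left ac_simps)
      finally have 1: "sum w A \<le> 16 * H * (q * s\<^sup>2) * 2 ^ J" using half by linarith
      have "2 * (q * s\<^sup>2) * L + 1 \<le> (2 * q * L + 1) * s\<^sup>2"
        using one_le_power[OF s, of 2] by (simp add: algebra_simps)
      then have "sqrt (2 * (q * s\<^sup>2) * L + 1) \<le> sqrt ((2 * q * L + 1) * s\<^sup>2)"
        by (rule real_sqrt_le_mono)
      also have "\<dots> = sqrt (2 * q * L + 1) * s" using s by (simp add: real_sqrt_mult)
      finally have "2 ^ J \<le> 2 * (sqrt (2 * q * L + 1) * s)" using J(2) by linarith
      then have "16 * H * (q * s\<^sup>2) * 2 ^ J \<le> 16 * H * (q * s\<^sup>2) * (2 * (sqrt (2 * q * L + 1) * s))"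
        using H(1) q0 by (intro mult_left_mono) auto
      also have "\<dots> = Z * s ^ 3" by (simp add: Z_def power2_eq_square power3_eq_cube)
      finally show ?thesis using w(2) 1 by linarith
    qed
    have "S \<noteq> {}" by (auto simp: S_def intro: exI[of _ "\<lambda>_. 0"])
    then have "Sup S \<le> Z * s ^ 3"
      by (rule cSup_least) (auto simp: S_def intro: bound)
    then have "\<Phi> \<le> max 1 (Z * s ^ 3)" by (auto simp: \<Phi>_def)
    also have "\<dots> \<le> max 1 Z * s ^ 3"
    proof (rule max.boundedI)
      have "1 * 1 \<le> max 1 Z * s ^ 3" using s by (intro mult_mono) auto
      then show "1 \<le> max 1 Z * s ^ 3" by simp
      show "Z * s ^ 3 \<le> max 1 Z * s ^ 3" using s by (intro mult_right_mono) auto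
    qed
    \<comment> \<open>The left side is \<open>\<Phi>\<close>, and \<open>s ^ 3\<close>
      cancels.\<close>
    finally have "s * s ^ 3 \<le> max 1 Z * s ^ 3" using s4 by (simp add: eval_nat_numeral)
    then have "s \<le> max 1 Z" using s by simp
    then have "\<Phi> \<le> (max 1 Z) ^ 4" unfolding s4[symmetric] using s by (intro power_mono) auto
    moreover have "norm (\<Sum>n\<in>A. smul (c0 n) (x n)) \<le> \<Phi>" by (rule \<Phi>) (rule c0)
    ultimately show "norm (\<Sum>n\<in>A. smul (c0 n) (x n)) \<le> (max 1 Z) ^ 4" by linarith
  qed
qed

end

section \<open>The isomorphism with c0\<close>

lemma c0_bdd_above:
  assumes "a \<in> c0"
  shows "bdd_above (range (\<lambda>n. norm (a n)))"
proof -
  have "Bseq a" using assms unfolding c0_def by (intro convergent_imp_Bseq convergentI) simp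
  then obtain C where "\<And>n. norm (a n) \<le> C" by (auto simp: Bseq_def)
  then show ?thesis by (intro bdd_aboveI[of _ C]) auto
qed

lemma norm_le_c0_norm: "a \<in> c0 \<Longrightarrow> norm (a n) \<le> c0_norm a"
  unfolding c0_norm_def by (rule cSUP_upper[OF _ c0_bdd_above]) auto

lemma c0_norm_le: "(\<And>n. norm (a n) \<le> e) \<Longrightarrow> c0_norm a \<le> e"
  unfolding c0_norm_def by (rule cSUP_least) auto

context banach_over
begin

lemma smul_scaleR: "smul c (r *\<^sub>R v) = r *\<^sub>R smul c v"
  unfolding smul_of_real[symmetric] by (rule scale_left_commute)

lemma bounded_linear_smul: "bounded_linear (smul c)"
  by (rule bounded_linear_intro[of _ "norm c"]) (simp_all add: scale_right_distrib smul_scaleR norm_smul mult.commute)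

lemma norm_sum_le_scaled:
  assumes M: "\<And>c. (\<And>n. n \<in> A \<Longrightarrow> norm (c n) \<le> 1) \<Longrightarrow> norm (\<Sum>n\<in>A. smul (c n) (x n)) \<le> M"
    and c: "\<And>n. n \<in> A \<Longrightarrow> norm (c n) \<le> e" and e: "0 < e"
  shows "norm (\<Sum>n\<in>A. smul (c n) (x n)) \<le> M * e"
proof -
  have "smul (c n) (x n) = e *\<^sub>R smul (of_real (inverse e) * c n) (x n)" for n
    using e by (simp only: scale_scale[symmetric] smul_of_real scaleR_scaleR) simp
  then have "(\<Sum>n\<in>A. smul (c n) (x n)) = e *\<^sub>R (\<Sum>n\<in>A. smul (of_real (inverse e) * c n) (x n))"
    by (simp only: scaleR_sum_right)
  then have "norm (\<Sum>n\<in>A. smul (c n) (x n)) = e * norm (\<Sum>n\<in>A. smul (of_real (inverse e) * c n) (x n))"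
    using e by (simp only: norm_scaleR abs_of_pos)
  also have "\<dots> \<le> e * M"
  proof (intro mult_left_mono M)
    show "norm (of_real (inverse e) * c n) \<le> 1" if "n \<in> A" for n
      using c[OF that] e by (simp add: norm_mult norm_inverse norm_divide divide_le_eq inverse_eq_divide)
  qed (use e in simp)
  finally show ?thesis by (simp add: mult.commute)
qed

end

context bounded_basis
begin

text \<open>The uniform bound on tails makes the series with coefficients in \<open>c0\<close>
  converge and gives the upper estimate; the bounded coordinate functionals give the lower one.
  Surjectivity holds because resumming the coordinates of a vector is bounded and is the identity on
  the dense span.\<close>

lemma equivalent_to_c0_basisI:
  assumes M: "\<And>A c. finite A \<Longrightarrow> (\<And>n. n \<in> A \<Longrightarrow> norm (c n) \<le> 1) \<Longrightarrow>
      norm (\<Sum>n\<in>A. smul (c n) (x n)) \<le> M"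
  shows "equivalent_to_c0_basis smul x"
proof -
  have M0: "0 \<le> M" using M[of "{}" "\<lambda>_. 0"] by simp
  have scaled: "norm (\<Sum>n\<in>A. smul (c n) (x n)) \<le> M * e"
    if "finite A" "\<And>n. n \<in> A \<Longrightarrow> norm (c n) \<le> e" "0 < e" for A c e
    by (rule norm_sum_le_scaled[OF _ that(2,3)]) (rule M[OF that(1)])
  have summ: "summable (\<lambda>n. smul (a n) (x n))" if a: "a \<in> c0" for a
    unfolding summable_Cauchy
  proof (intro allI impI)
    fix e :: real assume e: "0 < e"
    \<comment> \<open>\<open>M + 1\<close> avoids division by zero and makes
      \<open>M * d < e\<close> strict.\<close>
    define d where "d = e / (M + 1)"
    have d: "0 < d" "M * d < e" using e M0 by (auto simp: d_def field_simps)
    have "a \<longlonglongrightarrow> 0" using a by (simp add: c0_def)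
    from tendstoD[OF this d(1)] obtain N where N: "\<And>n. n \<ge> N \<Longrightarrow> norm (a n) < d"
      by (auto simp: eventually_sequentially)
    have "norm (\<Sum>n=m..<n. smul (a n) (x n)) < e" if "N \<le> m" for m n
    proof (rule order.strict_trans1[OF _ d(2)])
      show "norm (\<Sum>n=m..<n. smul (a n) (x n)) \<le> M * d"
        using N that by (intro scaled d(1)) (auto intro!: less_imp_le)
    qed
    then show "\<exists>N. \<forall>m\<ge>N. \<forall>n. norm (\<Sum>n=m..<n. smul (a n) (x n)) < e" by blast
  qed
  define \<Phi> where "\<Phi> a = (\<Sum>n. smul (a n) (x n))" for a
  have sums: "(\<lambda>n. smul (a n) (x n)) sums \<Phi> a" if "a \<in> c0" for a
    unfolding \<Phi>_def by (rule summable_sums[OF summ[OF that]])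
  have norm_\<Phi>: "norm (\<Phi> a) \<le> M * e" if a: "a \<in> c0" and e: "\<And>n. norm (a n) \<le> e" for a e
  proof -
    \<comment> \<open>\<open>scaled\<close> needs a positive bound while \<open>e\<close> may be 0,
      so the estimate is shown for \<open>d > e\<close> and \<open>d\<close> then tends to
      \<open>e\<close>.\<close>
    have "norm (\<Phi> a) \<le> M * d" if d: "e < d" for d
    proof (rule LIMSEQ_le_const2)
      show "(\<lambda>m. norm (\<Sum>n<m. smul (a n) (x n))) \<longlonglongrightarrow> norm (\<Phi> a)"
        using sums[OF a] by (intro tendsto_norm) (simp add: sums_def)
      have "0 < d" using d e[of 0] norm_ge_zero[of "a 0"] by linarith
      then show "\<exists>N. \<forall>m\<ge>N. norm (\<Sum>n<m. smul (a n) (x n)) \<le> M * d"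
        using e d by (intro exI[of _ 0] allI impI scaled) (auto intro: less_imp_le order_trans)
    qed
    moreover have "((\<lambda>d. M * d) \<longlongrightarrow> M * e) (at_right e)" by (intro tendsto_intros)
    ultimately show ?thesis
      by (intro tendsto_lowerbound[of "\<lambda>d. M * d" "M * e" "at_right e"])
        (auto simp: eventually_at_right_less intro: eventually_mono[OF eventually_at_right_less])
  qed
  have coord_\<Phi>: "xs m (\<Phi> a) = a m" if "a \<in> c0" for a m
  proof -
    have "(\<lambda>n. xs m (smul (a n) (x n))) sums xs m (\<Phi> a)"
      by (rule bounded_linear.sums[OF blinfun.bounded_linear_right sums[OF that]])
    moreover have "(\<lambda>n. xs m (smul (a n) (x n))) = (\<lambda>n. if n = m then a n else 0)" by auto
    ultimately show ?thesis using sums_single[of m a] sums_unique2 by metis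
  qed
  have add: "\<Phi> (\<lambda>n. a n + b n) = \<Phi> a + \<Phi> b" if "a \<in> c0" "b \<in> c0" for a b
    using suminf_add[OF summ[OF that(1)] summ[OF that(2)]] by (simp add: \<Phi>_def scale_left_distrib)
  have scale: "\<Phi> (\<lambda>n. c * a n) = smul c (\<Phi> a)" if "a \<in> c0" for a c
    using bounded_linear.suminf[OF bounded_linear_smul summ[OF that], of c] by (simp add: \<Phi>_def)
  have unit: "\<Phi> (\<lambda>m. if m = n then 1 else 0) = x n" for n
  proof -
    have "(\<lambda>m. smul (if m = n then 1 else 0) (x m)) = (\<lambda>m. if m = n then x m else 0)" by auto
    then show ?thesis using sums_unique[OF sums_single[of n x]] by (simp add: \<Phi>_def)
  qed
  have coords_c0: "(\<lambda>n. xs n f) \<in> c0" for f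
    using coord_tendsto_zero by (simp add: c0_def)
  define P where "P f = \<Phi> (\<lambda>n. xs n f)" for f
  have P_add: "P (f + g) = P f + P g" for f g
    unfolding P_def blinfun.add_right by (rule add) (rule coords_c0)+
  have P_smul: "P (smul c f) = smul c (P f)" for c f
    unfolding P_def coord_smul by (rule scale[OF coords_c0])
  have "subspace {g. P g = g}"
    using P_smul[of 0 0] by (intro subspaceI) (auto simp: P_add P_smul)
  moreover have "range x \<subseteq> {g. P g = g}" using unit by (auto simp: P_def)
  ultimately have P_span: "P g = g" if "g \<in> span (range x)" for g
    using span_minimal that by blast
  have P: "P f = f" for f
  proof (rule ccontr)
    assume "P f \<noteq> f"
    have pos: "0 < M * L + 1" using M0 L_pos by (simp add: add_nonneg_pos)
    then have "0 < norm (P f - f) / (M * L + 1)" using \<open>P f \<noteq> f\<close> by simp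
    then obtain g where g: "g \<in> span (range x)" "norm (f - g) < norm (P f - f) / (M * L + 1)"
      by (rule span_approx)
    \<comment> \<open>\<open>P\<close> fixes \<open>g\<close>, so the defect of \<open>f\<close>
      equals that of \<open>f - g\<close>, at most \<open>M * L + 1\<close> times its norm.\<close>
    have "P f = P (f - g) + g" using P_add[of "f - g" g] P_span[OF g(1)] by simp
    then have "P f - f = P (f - g) - (f - g)" by simp
    then have "norm (P f - f) \<le> norm (P (f - g)) + norm (f - g)" by (simp only: norm_triangle_ineq4)
    also have "norm (P (f - g)) \<le> M * (L * norm (f - g))"
      unfolding P_def by (rule norm_\<Phi>[OF coords_c0 norm_coord_le])
    finally have "norm (P f - f) \<le> (M * L + 1) * norm (f - g)" by (simp add: algebra_simps)
    also have "\<dots> < norm (P f - f)" using g(2) pos by (simp add: field_simps)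
    finally show False by simp
  qed
  have "c0_isomorphism smul \<Phi>"
    unfolding c0_isomorphism_def
  proof (intro conjI ballI allI)
    show "\<Phi> (\<lambda>n. a n + b n) = \<Phi> a + \<Phi> b" if "a \<in> c0" "b \<in> c0" for a b using that by (rule add)
    show "\<Phi> (\<lambda>n. c * a n) = smul c (\<Phi> a)" if "a \<in> c0" for c a using that by (rule scale)
    show "bij_betw \<Phi> c0 UNIV"
    proof (rule bij_betwI[of _ _ _ "\<lambda>f n. xs n f"])
      show "\<Phi> (\<lambda>n. xs n f) = f" for f using P by (simp add: P_def)
    qed (auto simp: coord_\<Phi> coords_c0)
    show "\<exists>M. \<forall>a\<in>c0. norm (\<Phi> a) \<le> M * c0_norm a"
      by (intro exI[of _ M] ballI norm_\<Phi> norm_le_c0_norm)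
    have "c0_norm a \<le> L * norm (\<Phi> a)" if "a \<in> c0" for a
      using norm_coord_le[of _ "\<Phi> a"] by (intro c0_norm_le) (simp add: coord_\<Phi>[OF that])
    then show "\<exists>M. \<forall>a\<in>c0. c0_norm a \<le> M * norm (\<Phi> a)" by blast
  qed
  then show ?thesis using unit by (auto simp: equivalent_to_c0_basis_def)
qed

end

theorem theorem4p4:
  fixes smul :: "'k::real_or_complex \<Rightarrow> 'a::banach \<Rightarrow> 'a"
    and x :: "nat \<Rightarrow> 'a" and xs :: "nat \<Rightarrow> 'a \<Rightarrow>\<^sub>L 'k"
    and t K :: real
  assumes "banach_over smul"
    and "infinite_dimensional smul"
    and "separable_space (euclidean :: 'a topology)"
    and "basis smul x xs"
    and "nearly_unconditional smul x xs"
    and "0 \<le> t" and "t < 1 / 2"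
    and "\<And>a. 0 < a \<Longrightarrow> a < 1 \<Longrightarrow> nearly_tqg_function smul x xs a \<le> ereal (K * a powr (- t))"
    and "GT_space dual_scale (dual_space smul)"
  shows "equivalent_to_c0_basis smul x"
proof -
  obtain L1 where L1: "\<And>n. norm (x n) \<le> L1"
    using assms(4) by (auto simp: basis_def bounded_iff)
  obtain L2 where L2: "\<And>n. norm (xs n) \<le> L2"
    using assms(4) by (auto simp: basis_def bounded_iff)
  define L where "L = max 1 (max L1 L2)"
  interpret banach_over smul by (rule assms(1))
  interpret bounded_basis smul x xs L
  proof
    show "norm (x n) \<le> L" "norm (xs n) \<le> L" for n
      using L1[of n] L2[of n] by (auto simp: L_def)
  qed (auto simp: L_def assms(4))
  have "(1/2 :: real) \<in> {0<..<1}" by simp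
  then obtain C0 where C0: "\<forall>f\<in>unit_coordinates xs. \<forall>A\<subseteq>large_coordinates xs (1/2) f.
      norm (coordinate_projection smul x xs A f) \<le> C0 * norm f"
    using assms(5) unfolding nearly_unconditional_def by blast
  define C where "C = max C0 0"
  have C: "0 \<le> C" by (simp add: C_def)
  have proj: "norm (coordinate_projection smul x xs A f) \<le> C * norm f"
    if "f \<in> unit_coordinates xs" "A \<subseteq> large_coordinates xs (1/2) f" for f A
  proof -
    have "norm (coordinate_projection smul x xs A f) \<le> C0 * norm f" using C0 that by blast
    also have "\<dots> \<le> C * norm f" by (intro mult_right_mono) (auto simp: C_def)
    finally show ?thesis .
  qed
  \<comment> \<open>With a = 4^-(j+1), division by \<open>a\<close> gives \<open>4 ^ Suc j\<close>
    and the truncation bound gives \<open>2 ^ Suc j\<close>; their product is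
    \<open>8 * 8 ^ j\<close>. The 1 added to \<open>\<bar>K\<bar>\<close> pays for the strict
    inequality used to extract an admissible constant.\<close>
  define H where "H = 8 * C * (\<bar>K\<bar> + 1)"
  have level: "norm (\<Sum>n\<in>B. smul (sgn (xs n f)) (x n)) \<le> H * 8 ^ j * norm f"
    if f: "f \<in> unit_coordinates xs" and B: "B \<subseteq> large_coordinates xs ((1/4) ^ Suc j) f" for f j B
  proof -
    define a :: real where "a = (1/4) ^ Suc j"
    have a: "0 < a" "a < 1" unfolding a_def by (rule zero_less_power, simp) (rule power_Suc_less_one, auto)
    have cancel: "inverse a * (a * y) = y" for y using a by simp
    have inv: "inverse a = 4 ^ Suc j" by (simp add: a_def power_divide)
    have "sqrt a = (1/2) ^ Suc j"
      unfolding a_def real_sqrt_power by (simp add: real_sqrt_divide)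
    then have root: "a powr (- (1/2)) = 2 ^ Suc j"
      using a by (simp add: powr_minus powr_half_sqrt power_divide)
    \<comment> \<open>As \<open>a < 1\<close>, raising \<open>t\<close> to 1/2 only enlarges the
      bound and makes it an integer power of 2.\<close>
    have "a powr (- t) \<le> a powr (- (1/2))"
      using a assms(7) by (intro powr_mono') auto
    then have "a powr (- t) \<le> 2 ^ Suc j" by (simp only: root)
    then have "K * a powr (- t) \<le> \<bar>K\<bar> * 2 ^ Suc j" by (intro mult_mono) auto
    moreover have "1 \<le> (2 :: real) ^ Suc j" by (rule one_le_power) simp
    ultimately have D: "K * a powr (- t) + 1 \<le> (\<bar>K\<bar> + 1) * 2 ^ Suc j"
      unfolding distrib_right by linarith
    have "nearly_tqg_function smul x xs a < ereal (K * a powr (- t) + 1)"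
      using assms(8)[OF a] by (rule order.strict_trans1) simp
    then have "norm (restricted_truncation smul x xs a f) \<le> (K * a powr (- t) + 1) * norm f"
      using f by (rule norm_restricted_truncation_le)
    also have "\<dots> \<le> (\<bar>K\<bar> + 1) * 2 ^ Suc j * norm f" by (intro mult_right_mono D) simp
    finally have "C * norm (restricted_truncation smul x xs a f) \<le> C * ((\<bar>K\<bar> + 1) * 2 ^ Suc j * norm f)"
      using C by (rule mult_left_mono)
    with norm_sign_sum_le[OF C proj a(1) B[folded a_def]]
    have "a * norm (\<Sum>n\<in>B. smul (sgn (xs n f)) (x n)) \<le> C * ((\<bar>K\<bar> + 1) * 2 ^ Suc j * norm f)"
      by linarith
    then have "inverse a * (a * norm (\<Sum>n\<in>B. smul (sgn (xs n f)) (x n)))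
        \<le> inverse a * (C * ((\<bar>K\<bar> + 1) * 2 ^ Suc j * norm f))"
      using a by (intro mult_left_mono) auto
    then have "norm (\<Sum>n\<in>B. smul (sgn (xs n f)) (x n))
        \<le> 4 ^ Suc j * (C * ((\<bar>K\<bar> + 1) * 2 ^ Suc j * norm f))"
      unfolding cancel unfolding inv .
    also have "\<dots> = C * (\<bar>K\<bar> + 1) * (4 ^ Suc j * 2 ^ Suc j) * norm f" by (simp only: ac_simps)
    also have "(4 :: real) ^ Suc j * 2 ^ Suc j = 8 * 8 ^ j"
      using power_mult_distrib[of "4 :: real" 2 j] by simp
    finally show ?thesis by (simp only: H_def ac_simps)
  qed
  have "0 \<le> H" using C by (simp add: H_def)
  show ?thesis
  proof (rule sums_uniformly_bounded[OF assms(9) \<open>0 \<le> H\<close>])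
    show "norm (\<Sum>n\<in>B. smul (sgn (xs n f)) (x n)) \<le> H * 8 ^ j * norm f"
      if "f \<in> unit_coordinates xs" "B \<subseteq> large_coordinates xs ((1/4) ^ Suc j) f" for f j B
      using that by (rule level)
    show "equivalent_to_c0_basis smul x"
      if "\<And>A c. finite A \<Longrightarrow> (\<And>n. n \<in> A \<Longrightarrow> norm (c n) \<le> 1) \<Longrightarrow>
        norm (\<Sum>n\<in>A. smul (c n) (x n)) \<le> M" for M
      using that by (rule equivalent_to_c0_basisI)
  qed
qed

end
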